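(* Let $f$ be a complex-valued function that is continuous on $\overline{\mathbb{U}}$ and harmonic in the unit disk $\mathbb{U}$, write $f=g+\overline{h}$ with $g,h$ holomorphic in $\mathbb{U}$, and suppose that the closed curve $\gamma(t)=f(e^{it})$, $t\in[0,2\pi]$, is rectifiable, with length $L$. Write $g(z)=\sum_{k\ge0}\hat g_kz^k$. Then: a) $2\pi k|\hat g_k|\le L$ for all $k\ge0$. a1) In particular $2\pi|g'(0)|\le L$; and in the case $a:=g'(0)>0$ equality holds if and only if there is a holomorphic function $H$ on $\mathbb{U}$ having a zero of order at least $2$ at $0$ such that $g'=-H+a$, $h'=z^{-2}H$ and $2H\in\mathcal{P}_a$. a2) $2\pi\max\{|g'(0)|,|h'(0)|\}\le L$. a3) $2\pi|g'(0)|\le L$, with equality if and only if $f=c f^{\nu}+c_1$ for some $c,c_1\in\mathbb{C}$ and some admissible $\nu$. b) For every $z\in\mathbb{U}$, $2\pi(1-|z|^2)|g'(z)|\le L$, with equality if and only if $f=c\,f^{\nu}\circ\varphi_z+c_1$ for some $c,c_1\in\mathbb{C}$ and some admissible $\nu$. b1) For every $z\in\mathbb{U}$, $2\pi(1-|z|^2)\lambda_f(z)\le L$.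
   Context: $\mathbb{U}$ is the open unit disk in $\mathbb{C}$; $\varphi_z(w)=\frac{z-w}{1-\overline{z}w}$; $\lambda_f(z)=\big||\partial f(z)|-|\bar\partial f(z)|\big|=\big||g'(z)|-|h'(z)|\big|$. For $a\in\mathbb{R}$, $\mathcal{P}_a$ is the family of holomorphic functions $\phi$ on $\mathbb{U}$ with $\operatorname{Re}\phi<a$ on $\mathbb{U}$. "Zero of order at least 2 at $0$" allows the zero function. A holomorphic function $\nu$ on $\mathbb{U}$ is called admissible if $\nu(z)=z^{-2}\omega(z)$ for some holomorphic $\omega:\mathbb{U}\to\mathbb{U}$ having a zero of order at least $2$ at $0$. For admissible $\nu$, $f^\nu=G+\overline{K}$ where $G,K$ are the holomorphic functions on $\mathbb{U}$ with $G(0)=K(0)=0$ and $$G'(z)=\frac{1}{1+z^2\nu(z)},\qquad K'(z)=\frac{\nu(z)}{1+z^2\nu(z)}.$$ *)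

theory Defs
  imports "HOL-Complex_Analysis.Complex_Analysis"
begin

abbreviation unit_disk :: "complex set" where
  "unit_disk \<equiv> ball 0 1"

(* Twice continuously real-differentiable with vanishing Laplacian; fx, fy, fxx, ... are the
   partial derivatives in the coordinates z = x + i y. *)
definition harmonic_on :: "(complex \<Rightarrow> complex) \<Rightarrow> complex set \<Rightarrow> bool" where
  "harmonic_on f S \<longleftrightarrow> open S \<and>
    (\<exists>fx fy fxx fxy fyx fyy.
      continuous_on S fxx \<and> continuous_on S fxy \<and> continuous_on S fyx \<and> continuous_on S fyy \<and>
      (\<forall>z\<in>S.
        (f has_derivative (\<lambda>v. Re v *\<^sub>R fx z + Im v *\<^sub>R fy z)) (at z) \<and>
        (fx has_derivative (\<lambda>v. Re v *\<^sub>R fxx z + Im v *\<^sub>R fxy z)) (at z) \<and>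
        (fy has_derivative (\<lambda>v. Re v *\<^sub>R fyx z + Im v *\<^sub>R fyy z)) (at z) \<and>
        fxx z + fyy z = 0))"

(* Lengths of the polygons inscribed in a curve. *)
definition polygonal_sums :: "(real \<Rightarrow> 'a::metric_space) \<Rightarrow> real \<Rightarrow> real \<Rightarrow> real set" where
  "polygonal_sums \<gamma> a b =
    {(\<Sum>i<n. dist (\<gamma> (s i)) (\<gamma> (s (Suc i)))) | n s.
       s 0 = a \<and> s n = b \<and> (\<forall>i<n. s i \<le> s (Suc i))}"

definition rectifiable_curve :: "(real \<Rightarrow> 'a::metric_space) \<Rightarrow> real \<Rightarrow> real \<Rightarrow> bool" where
  "rectifiable_curve \<gamma> a b \<longleftrightarrow> bdd_above (polygonal_sums \<gamma> a b)"

definition curve_length :: "(real \<Rightarrow> 'a::metric_space) \<Rightarrow> real \<Rightarrow> real \<Rightarrow> real" where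
  "curve_length \<gamma> a b = Sup (polygonal_sums \<gamma> a b)"

(* The Wirtinger derivatives (f_x - i f_y) / 2 and (f_x + i f_y) / 2. *)
definition wirtinger_d :: "(complex \<Rightarrow> complex) \<Rightarrow> complex \<Rightarrow> complex" where
  "wirtinger_d f z =
    (frechet_derivative f (at z) 1 - \<i> * frechet_derivative f (at z) \<i>) / 2"

definition wirtinger_dbar :: "(complex \<Rightarrow> complex) \<Rightarrow> complex \<Rightarrow> complex" where
  "wirtinger_dbar f z =
    (frechet_derivative f (at z) 1 + \<i> * frechet_derivative f (at z) \<i>) / 2"

definition lambda_min :: "(complex \<Rightarrow> complex) \<Rightarrow> complex \<Rightarrow> real" where
  "lambda_min f z = \<bar>norm (wirtinger_d f z) - norm (wirtinger_dbar f z)\<bar>"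

(* The involutive disk automorphism exchanging 0 and z; it differs by a sign from
   Moebius_function 0 z. *)
definition disk_aut :: "complex \<Rightarrow> complex \<Rightarrow> complex" where
  "disk_aut z w = (z - w) / (1 - cnj z * w)"

definition halfplane_family :: "real \<Rightarrow> (complex \<Rightarrow> complex) set" where
  "halfplane_family a = {\<phi>. \<phi> holomorphic_on unit_disk \<and> (\<forall>z\<in>unit_disk. Re (\<phi> z) < a)}"

(* The zero function is included explicitly because zorder is unspecified for it. *)
definition zero_of_order_ge :: "nat \<Rightarrow> (complex \<Rightarrow> complex) \<Rightarrow> bool" where
  "zero_of_order_ge n F \<longleftrightarrow> (\<forall>z\<in>unit_disk. F z = 0) \<or> zorder F 0 \<ge> int n"

(* The identity nu = omega / z^2 is required away from 0; at 0 it is a removable singularity. *)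
definition admissible :: "(complex \<Rightarrow> complex) \<Rightarrow> bool" where
  "admissible \<nu> \<longleftrightarrow> \<nu> holomorphic_on unit_disk \<and>
    (\<exists>\<omega>. \<omega> holomorphic_on unit_disk \<and> \<omega> ` unit_disk \<subseteq> unit_disk \<and> zero_of_order_ge 2 \<omega> \<and>
         (\<forall>z\<in>unit_disk - {0}. \<nu> z = \<omega> z / z ^ 2))"

(* Unique on the unit disk only, hence SOME rather than THE. *)
definition disk_primitive :: "(complex \<Rightarrow> complex) \<Rightarrow> complex \<Rightarrow> complex" where
  "disk_primitive p = (SOME P. P holomorphic_on unit_disk \<and> P 0 = 0 \<and>
     (\<forall>z\<in>unit_disk. (P has_field_derivative p z) (at z)))"

lemma disk_primitive:
  assumes "p holomorphic_on unit_disk"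
  shows "disk_primitive p holomorphic_on unit_disk" (is ?A)
    and "disk_primitive p 0 = 0" (is ?B)
    and "z \<in> unit_disk \<Longrightarrow> (disk_primitive p has_field_derivative p z) (at z)"
proof -
  obtain P where P: "\<And>z. z \<in> unit_disk \<Longrightarrow> (P has_field_derivative p z) (at z)"
    using holomorphic_convex_primitive'[OF _ _ assms] at_within_open[OF _ open_ball]
    by (metis convex_ball open_ball)
  define Q where "Q = (\<lambda>z. P z - P 0)"
  have Q: "(Q has_field_derivative p z) (at z)" if "z \<in> unit_disk" for z
    unfolding Q_def using P[OF that] by (auto intro!: derivative_eq_intros)
  have "Q holomorphic_on unit_disk"
    using Q holomorphic_on_open[of unit_disk Q] by blast
  hence "\<exists>P. P holomorphic_on unit_disk \<and> P 0 = 0 \<and>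
          (\<forall>z\<in>unit_disk. (P has_field_derivative p z) (at z))"
    using Q by (intro exI[of _ Q]) (auto simp: Q_def)
  from someI_ex[OF this] show ?A ?B
    "z \<in> unit_disk \<Longrightarrow> (disk_primitive p has_field_derivative p z) (at z)"
    unfolding disk_primitive_def by blast+
qed

definition extremal_map :: "(complex \<Rightarrow> complex) \<Rightarrow> complex \<Rightarrow> complex" where
  "extremal_map \<nu> w =
     disk_primitive (\<lambda>z. 1 / (1 + z ^ 2 * \<nu> z)) w +
     cnj (disk_primitive (\<lambda>z. \<nu> z / (1 + z ^ 2 * \<nu> z)) w)"

end

theory Submission
  imports Defs
begin

text \<open>
  Throughout, \<open>f = g + cnj h\<close>, \<open>L\<close> is the perimeter of \<open>f\<close> and
  \<open>z = r * cis t\<close>. On the circle of radius \<open>r\<close> the curve \<open>t \<mapsto> f z\<close> has velocity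
  \<open>\<i> * (z * g' z - cnj (z * h' z))\<close>, and its Fourier coefficient of index \<open>k > 0\<close> is
  \<open>\<i> * k * r ^ k\<close> times the \<open>k\<close>-th Taylor coefficient of \<open>g\<close>: conjugates of holomorphic functions
  contribute no positive frequencies. So the coefficient bound says that the absolute value of an
  integral is at most the integral of the absolute value, once the inner circles are known to have
  image of length at most \<open>L\<close>. The latter is the maximum principle, applied to inscribed polygons
  (\<open>inner_circle_perimeter_le\<close>).

  Equality at the origin, after normalising \<open>g' 0 = a > 0\<close>. Put \<open>q = g' z - cnj (z\<^sup>2 * h' z) / r\<^sup>2\<close>, so
  that the velocity is \<open>\<i> * z * q\<close>. The mean of \<open>q\<close> is \<open>a\<close>, while the mean of \<open>norm q\<close> is at most
  \<open>L / (2 * pi * r) = a / r\<close>. Hence \<open>norm q - Re q\<close>, which is nonnegative, has small mean as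
  \<open>r\<close> tends to 1, and then so has \<open>\<bar>Im q\<bar>\<close>. On the circle \<open>Re q\<close> and \<open>Im q\<close> are the real part of
  \<open>g' - z\<^sup>2 * h' / r\<^sup>2\<close> and the imaginary part of \<open>g' + z\<^sup>2 * h' / r\<^sup>2\<close>; the Poisson formula carries both
  facts to each fixed point of the disk, and the limit gives \<open>Re (g' - z\<^sup>2 * h') \<ge> 0\<close> and
  \<open>Im (g' + z\<^sup>2 * h') = 0\<close>, so \<open>g' + z\<^sup>2 * h'\<close> is the constant \<open>a\<close> (\<open>extremal_derivs\<close>). With
  \<open>H = z\<^sup>2 * h'\<close> this is the asserted structure; the inequality \<open>2 * Re H \<le> a\<close> is strict by the open mapping
  theorem, since \<open>H\<close> vanishes at 0.

  Conversely, if \<open>g' = a - H\<close> with \<open>2 * Re H \<le> a\<close>, then the speed on the circle of radius \<open>r\<close> is at most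
  \<open>r * (a - 2 * Re H)\<close> plus an error controlled by \<open>(1 - r) * norm (h' z)\<close>. The main term has integral
  \<open>2 * pi * a * r\<close>, and the error tends to 0 uniformly because \<open>f\<close> is uniformly continuous on the closed
  disk (\<open>little_Bloch_antiholomorphic_part\<close>); hence \<open>L \<le> 2 * pi * a\<close>
  (\<open>perimeter_le_if_extremal_derivs\<close>).

  The extremal maps arise from this through \<open>\<omega> = H / (1 - H)\<close>, with \<open>H\<close> normalised by \<open>a = 1\<close>: the condition
  \<open>Re H < 1 / 2\<close> is exactly \<open>norm \<omega> < 1\<close>. An arbitrary base point is moved to the origin by a disk
  automorphism, which only reparametrises the boundary curve and so preserves its length.
\<close>

section \<open>Lengths of inscribed polygons\<close>

lemma polygonal_sumsE:
  assumes "x \<in> polygonal_sums \<gamma> a b"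
  obtains n s where "x = (\<Sum>i<n. dist (\<gamma> (s i)) (\<gamma> (s (Suc i))))" "s 0 = a" "s n = b"
    "\<And>i. i < n \<Longrightarrow> s i \<le> s (Suc i)"
  using assms unfolding polygonal_sums_def by blast

lemma polygonal_sums_concat:
  assumes "x \<in> polygonal_sums \<gamma> a c" "y \<in> polygonal_sums \<gamma> c b"
  shows "x + y \<in> polygonal_sums \<gamma> a b"
proof -
  obtain n s where s: "x = (\<Sum>i<n. dist (\<gamma> (s i)) (\<gamma> (s (Suc i))))" "s 0 = a" "s n = c"
    "\<And>i. i < n \<Longrightarrow> s i \<le> s (Suc i)"
    using assms(1) by (elim polygonal_sumsE) blast
  obtain m t where t: "y = (\<Sum>i<m. dist (\<gamma> (t i)) (\<gamma> (t (Suc i))))" "t 0 = c" "t m = b"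
    "\<And>i. i < m \<Longrightarrow> t i \<le> t (Suc i)"
    using assms(2) by (elim polygonal_sumsE) blast
  define u where "u = (\<lambda>i. if i \<le> n then s i else t (i - n))"
  have u_left: "u i = s i" if "i \<le> n" for i using that by (simp add: u_def)
  have u_right: "u (n + i) = t i" for i using s(3) t(2) by (simp add: u_def)
  have "(\<Sum>i<n + m. dist (\<gamma> (u i)) (\<gamma> (u (Suc i)))) =
      (\<Sum>i<n. dist (\<gamma> (u i)) (\<gamma> (u (Suc i)))) + (\<Sum>i<m. dist (\<gamma> (u (n + i))) (\<gamma> (u (n + Suc i))))"
    by (induction m) simp_all
  also have "(\<Sum>i<n. dist (\<gamma> (u i)) (\<gamma> (u (Suc i)))) = x"
    unfolding s(1) by (intro sum.cong) (auto simp: u_left)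
  also have "(\<Sum>i<m. dist (\<gamma> (u (n + i))) (\<gamma> (u (n + Suc i)))) = y"
    unfolding t(1) u_right by simp
  finally have "x + y = (\<Sum>i<n + m. dist (\<gamma> (u i)) (\<gamma> (u (Suc i))))" by simp
  moreover have "u i \<le> u (Suc i)" if "i < n + m" for i
  proof (cases "i < n")
    case True
    thus ?thesis using s(4) by (simp add: u_left)
  next
    case False
    then obtain j where "i = n + j" by (metis le_iff_add not_less)
    thus ?thesis using that t(4)[of j] u_right[of j] u_right[of "Suc j"] by simp
  qed
  moreover have "u 0 = a" "u (n + m) = b" using s t u_right by (auto simp: u_def)
  ultimately show ?thesis unfolding polygonal_sums_def by blast
qed

text \<open>
  Truncating all partition points at \<open>c\<close> from above and from below gives partitions of the two
  halves without locating the step that crosses \<open>c\<close>: a step on one side of \<open>c\<close> is trivial in the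
  other half, and the crossing step is covered by the triangle inequality.
\<close>
lemma polygonal_sums_split:
  assumes "x \<in> polygonal_sums \<gamma> a b" "a \<le> c" "c \<le> b"
  obtains y z where "y \<in> polygonal_sums \<gamma> a c" "z \<in> polygonal_sums \<gamma> c b" "x \<le> y + z"
proof -
  obtain n s where s: "x = (\<Sum>i<n. dist (\<gamma> (s i)) (\<gamma> (s (Suc i))))" "s 0 = a" "s n = b"
    "\<And>i. i < n \<Longrightarrow> s i \<le> s (Suc i)"
    using assms(1) by (elim polygonal_sumsE) blast
  define u v where "u = (\<lambda>i. min (s i) c)" and "v = (\<lambda>i. max (s i) c)"
  have "(\<Sum>i<n. dist (\<gamma> (u i)) (\<gamma> (u (Suc i)))) \<in> polygonal_sums \<gamma> a c"
    unfolding polygonal_sums_def using s assms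
    by (auto intro!: exI[of _ n] exI[of _ u] simp: u_def min_def) (meson order_trans)
  moreover have "(\<Sum>i<n. dist (\<gamma> (v i)) (\<gamma> (v (Suc i)))) \<in> polygonal_sums \<gamma> c b"
    unfolding polygonal_sums_def using s assms
    by (auto intro!: exI[of _ n] exI[of _ v] simp: v_def max_def) (meson order_trans)
  moreover have "dist (\<gamma> (s i)) (\<gamma> (s (Suc i))) \<le>
      dist (\<gamma> (u i)) (\<gamma> (u (Suc i))) + dist (\<gamma> (v i)) (\<gamma> (v (Suc i)))" if "i < n" for i
  proof (cases "s i \<le> c \<and> c \<le> s (Suc i)")
    case True
    thus ?thesis
      using dist_triangle[of "\<gamma> (s i)" "\<gamma> (s (Suc i))" "\<gamma> c"]
      by (auto simp: u_def v_def min_def max_def)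
  next
    case False
    thus ?thesis using s(4)[OF that] by (auto simp: u_def v_def min_def max_def)
  qed
  ultimately show ?thesis
    using that unfolding s(1) sum.distrib[symmetric] by (metis (no_types, lifting) lessThan_iff sum.distrib sum_mono)
qed

lemma polygonal_sums_reparametrize:
  assumes "mono \<theta>"
  shows "polygonal_sums (\<lambda>t. \<gamma> (\<theta> t)) a b \<subseteq> polygonal_sums \<gamma> (\<theta> a) (\<theta> b)"
proof
  fix x assume "x \<in> polygonal_sums (\<lambda>t. \<gamma> (\<theta> t)) a b"
  then obtain n s where "x = (\<Sum>i<n. dist (\<gamma> (\<theta> (s i))) (\<gamma> (\<theta> (s (Suc i)))))" "s 0 = a" "s n = b"
    "\<And>i. i < n \<Longrightarrow> s i \<le> s (Suc i)"
    by (elim polygonal_sumsE) blast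
  thus "x \<in> polygonal_sums \<gamma> (\<theta> a) (\<theta> b)"
    unfolding polygonal_sums_def using assms
    by (auto simp: monoD intro!: exI[of _ n] exI[of _ "\<lambda>i. \<theta> (s i)"])
qed

text \<open>
  A polygon for the period starting at \<open>c\<close> is cut at the next multiple of \<open>2 * pi\<close>, and the second piece is
  moved back by one period in front of the first.
\<close>
lemma polygonal_sums_circle_base_point:
  assumes bound: "\<And>x. x \<in> polygonal_sums (\<lambda>t. F (cis t)) 0 (2 * pi) \<Longrightarrow> x \<le> M"
    and x: "x \<in> polygonal_sums (\<lambda>t. F (cis t)) c (c + 2 * pi)"
  shows "x \<le> M"
proof -
  define k c' where "k = \<lfloor>c / (2 * pi)\<rfloor>" and "c' = c - 2 * pi * k"
  have c': "0 \<le> c'" "c' \<le> 2 * pi"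
    using floor_divide_lower[of "2 * pi" c] floor_divide_upper[of "2 * pi" c]
    by (auto simp: c'_def k_def algebra_simps)
  have periodic: "cis (t + 2 * pi * of_int m) = cis t" for t m
    by (simp add: cis_mult[symmetric] cis_multiple_2pi)
  have shift: "polygonal_sums (\<lambda>t. F (cis t)) a b \<subseteq>
      polygonal_sums (\<lambda>t. F (cis t)) (a + 2 * pi * of_int m) (b + 2 * pi * of_int m)" for a b m
    using polygonal_sums_reparametrize[of "\<lambda>t. t + 2 * pi * of_int m" "\<lambda>t. F (cis t)" a b]
    by (simp add: periodic mono_def)
  have "x \<in> polygonal_sums (\<lambda>t. F (cis t)) c' (c' + 2 * pi)"
    using subsetD[OF shift[of c "c + 2 * pi" "- k"] x] by (simp add: c'_def algebra_simps)
  then obtain y z where yz: "y \<in> polygonal_sums (\<lambda>t. F (cis t)) c' (2 * pi)"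
      "z \<in> polygonal_sums (\<lambda>t. F (cis t)) (2 * pi) (c' + 2 * pi)" "x \<le> y + z"
    using polygonal_sums_split[of x _ c' "c' + 2 * pi" "2 * pi"] c' by auto
  have "z \<in> polygonal_sums (\<lambda>t. F (cis t)) 0 c'"
    using subsetD[OF shift[of "2 * pi" "c' + 2 * pi" "- 1"] yz(2)] by simp
  from bound[OF polygonal_sums_concat[OF this yz(1)]] yz(3) show ?thesis by simp
qed

text \<open>
  For a fine uniform partition, uniform continuity of \<open>\<gamma>'\<close> makes the speed on each step nearly
  constant, equal to the chord divided by the step up to \<open>\<epsilon>\<close>; so the integral exceeds an inscribed
  polygon by at most \<open>(b - a) * \<epsilon>\<close>.
\<close>
lemma integral_speed_le:
  fixes \<gamma> :: "real \<Rightarrow> 'a::euclidean_space"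
  assumes "a < b"
    and der: "\<And>t. t \<in> {a..b} \<Longrightarrow> (\<gamma> has_vector_derivative \<gamma>' t) (at t within {a..b})"
    and cont: "continuous_on {a..b} \<gamma>'"
    and bound: "\<And>x. x \<in> polygonal_sums \<gamma> a b \<Longrightarrow> x \<le> M"
  shows "integral {a..b} (\<lambda>t. norm (\<gamma>' t)) \<le> M"
proof (rule field_le_epsilon)
  fix e :: real assume "e > 0"
  define \<epsilon> where "\<epsilon> = e / (b - a)"
  have "\<epsilon> > 0" using \<open>a < b\<close> \<open>e > 0\<close> by (simp add: \<epsilon>_def)
  obtain \<delta> where \<delta>: "\<delta> > 0"
      "\<And>s t. s \<in> {a..b} \<Longrightarrow> t \<in> {a..b} \<Longrightarrow> dist s t < \<delta> \<Longrightarrow> dist (\<gamma>' s) (\<gamma>' t) < \<epsilon>"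
    using compact_uniformly_continuous[OF cont compact_Icc] \<open>\<epsilon> > 0\<close>
    unfolding uniformly_continuous_on_def by metis
  obtain n :: nat where n: "(b - a) / \<delta> < real n" using reals_Archimedean2 by blast
  have "(b - a) / \<delta> > 0" using \<open>a < b\<close> \<delta>(1) by simp
  with n have "n > 0" by (cases n) auto
  define h where "h = (b - a) / n"
  have h: "0 < h" "h < \<delta>" "n * h = b - a"
    using \<open>a < b\<close> \<open>n > 0\<close> n \<delta>(1) by (auto simp: h_def field_simps)
  define s where "s = (\<lambda>i::nat. a + i * h)"
  have s_Suc: "s (Suc i) = s i + h" for i by (simp add: s_def algebra_simps)
  have s_n: "s n = b" using h by (simp add: s_def)
  have s_in: "s i \<in> {a..b}" if "i \<le> n" for i
  proof -
    have "real i * h \<le> real n * h" using that h by (intro mult_right_mono) auto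
    thus ?thesis using h by (simp add: s_def)
  qed
  have speed_cont: "continuous_on {a..b} (\<lambda>t. norm (\<gamma>' t))"
    by (intro continuous_intros cont)
  have step: "integral {s i..s (Suc i)} (\<lambda>t. norm (\<gamma>' t)) \<le>
      dist (\<gamma> (s i)) (\<gamma> (s (Suc i))) + h * \<epsilon>" if "i < n" for i
  proof -
    let ?\<Delta> = "\<gamma> (s (Suc i)) - \<gamma> (s i)"
    have sub: "{s i..s (Suc i)} \<subseteq> {a..b}"
      using s_in[of i] s_in[of "Suc i"] that by auto
    have "norm (\<gamma>' t) \<le> norm ?\<Delta> / h + \<epsilon>" if t: "t \<in> {s i..s (Suc i)}" for t
    proof -
      have "norm (\<gamma> (s (Suc i)) - \<gamma> (s i) - (s (Suc i) - s i) *\<^sub>R \<gamma>' t) \<le> norm (s (Suc i) - s i) * \<epsilon>"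
      proof (rule vector_differentiable_bound_linearization)
        fix u assume u: "u \<in> {s i..s (Suc i)}"
        show "(\<gamma> has_vector_derivative \<gamma>' u) (at u within {s i..s (Suc i)})"
          using der[of u] u sub has_vector_derivative_within_subset by blast
        show "norm (\<gamma>' u - \<gamma>' t) \<le> \<epsilon>"
          using \<delta>(2)[of u t] u t sub h(2) s_Suc[of i]
          by (force simp: dist_norm dist_real_def)
      qed (use h(1) s_Suc[of i] t in \<open>auto simp: closed_segment_eq_real_ivl\<close>)
      hence "norm (?\<Delta> - h *\<^sub>R \<gamma>' t) \<le> h * \<epsilon>" using h(1) by (simp add: s_Suc)
      hence "h * norm (\<gamma>' t) \<le> norm ?\<Delta> + h * \<epsilon>"
        using norm_triangle_ineq2[of "h *\<^sub>R \<gamma>' t" ?\<Delta>] h(1) by (simp add: norm_minus_commute)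
      thus ?thesis using h(1) by (simp add: field_simps)
    qed
    hence "integral {s i..s (Suc i)} (\<lambda>t. norm (\<gamma>' t)) \<le>
        integral {s i..s (Suc i)} (\<lambda>t. norm ?\<Delta> / h + \<epsilon>)"
      by (intro integral_le integrable_continuous_interval continuous_on_subset[OF speed_cont sub])
        auto
    also have "\<dots> = norm ?\<Delta> + h * \<epsilon>"
      using h(1) by (simp add: s_Suc field_simps)
    finally show ?thesis by (simp add: dist_norm norm_minus_commute)
  qed
  have "integral {a..s k} (\<lambda>t. norm (\<gamma>' t)) \<le>
      (\<Sum>i<k. dist (\<gamma> (s i)) (\<gamma> (s (Suc i)))) + k * (h * \<epsilon>)" if "k \<le> n" for k
    using that
  proof (induction k)
    case 0
    show ?case by (simp add: s_def)
  next
    case (Suc k)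
    have "integral {a..s k} (\<lambda>t. norm (\<gamma>' t)) + integral {s k..s (Suc k)} (\<lambda>t. norm (\<gamma>' t)) =
        integral {a..s (Suc k)} (\<lambda>t. norm (\<gamma>' t))"
      using s_in[of k] s_in[of "Suc k"] Suc.prems h(1)
      by (intro Henstock_Kurzweil_Integration.integral_combine integrable_continuous_interval
          continuous_on_subset[OF speed_cont]) (auto simp: s_Suc)
    thus ?case using Suc step[of k] by (simp add: algebra_simps)
  qed
  from this[of n] have "integral {a..b} (\<lambda>t. norm (\<gamma>' t)) \<le>
      (\<Sum>i<n. dist (\<gamma> (s i)) (\<gamma> (s (Suc i)))) + (n * h) * \<epsilon>"
    by (simp add: s_n algebra_simps)
  moreover have "(\<Sum>i<n. dist (\<gamma> (s i)) (\<gamma> (s (Suc i)))) \<in> polygonal_sums \<gamma> a b"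
    unfolding polygonal_sums_def using s_n h(1)
    by (auto intro!: exI[of _ n] exI[of _ s] simp: s_def algebra_simps)
  ultimately show "integral {a..b} (\<lambda>t. norm (\<gamma>' t)) \<le> M + e"
    using bound h(3) \<open>a < b\<close> by (fastforce simp: \<epsilon>_def)
qed

lemma polygonal_sums_nonempty: "a \<le> b \<Longrightarrow> polygonal_sums \<gamma> a b \<noteq> {}"
  unfolding polygonal_sums_def
  by (auto intro!: exI[of _ "1::nat"] exI[of _ "\<lambda>i. if i = 0 then a else b"])

lemma polygonal_sums_le_curve_length:
  "rectifiable_curve \<gamma> a b \<Longrightarrow> x \<in> polygonal_sums \<gamma> a b \<Longrightarrow> x \<le> curve_length \<gamma> a b"
  unfolding rectifiable_curve_def curve_length_def by (rule cSup_upper)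

lemma curve_length_le:
  "a \<le> b \<Longrightarrow> (\<And>x. x \<in> polygonal_sums \<gamma> a b \<Longrightarrow> x \<le> M) \<Longrightarrow> curve_length \<gamma> a b \<le> M"
  unfolding curve_length_def by (rule cSup_least[OF polygonal_sums_nonempty])

lemma curve_length_dilation_le:
  assumes "\<And>s t. dist (\<delta> s) (\<delta> t) = k * dist (\<gamma> s) (\<gamma> t)" "0 \<le> k" "a \<le> b" "rectifiable_curve \<gamma> a b"
  shows "rectifiable_curve \<delta> a b" "curve_length \<delta> a b \<le> k * curve_length \<gamma> a b"
proof -
  have "x \<le> k * curve_length \<gamma> a b" if x: "x \<in> polygonal_sums \<delta> a b" for x
  proof -
    obtain n s where s: "x = (\<Sum>i<n. dist (\<delta> (s i)) (\<delta> (s (Suc i))))" "s 0 = a" "s n = b"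
      "\<And>i. i < n \<Longrightarrow> s i \<le> s (Suc i)"
      using x by (elim polygonal_sumsE) blast
    have "(\<Sum>i<n. dist (\<gamma> (s i)) (\<gamma> (s (Suc i)))) \<in> polygonal_sums \<gamma> a b"
      using s unfolding polygonal_sums_def by blast
    from mult_left_mono[OF polygonal_sums_le_curve_length[OF assms(4) this] assms(2)]
    show ?thesis by (simp add: s(1) assms(1) sum_distrib_left)
  qed
  thus "rectifiable_curve \<delta> a b" "curve_length \<delta> a b \<le> k * curve_length \<gamma> a b"
    using assms(3) unfolding rectifiable_curve_def
    by - (rule bdd_aboveI, blast, rule curve_length_le, blast+)
qed

section \<open>Integrals over circles\<close>

lemma has_integral_circle:
  fixes F :: "complex \<Rightarrow> complex"
  assumes "(F has_contour_integral I) (circlepath 0 r)"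
  shows "((\<lambda>t. F (r * cis t) * (r * cis t)) has_integral I / \<i>) {0..2 * pi}"
proof -
  have "((\<lambda>t. F (r * cis t) * r * \<i> * cis t) has_integral I) {0..2 * pi}"
    using assms by (simp add: circlepath_def has_contour_integral_part_circlepath_iff)
  from has_integral_mult_right[OF this, of "1 / \<i>"] show ?thesis
    by (simp add: mult_ac)
qed

lemma Cauchy_integral_circle:
  fixes F :: "complex \<Rightarrow> complex"
  assumes "F holomorphic_on cball 0 r" "norm w < r"
  shows "((\<lambda>t. F (r * cis t) * (r * cis t / (r * cis t - w))) has_integral 2 * pi * F w) {0..2 * pi}"
  using has_integral_circle[OF Cauchy_integral_circlepath_simple[of F 0 r w]] assms
  by (simp add: mult_ac)

lemma mean_value_circle:
  fixes F :: "complex \<Rightarrow> complex"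
  assumes "F holomorphic_on cball 0 r" "0 < r"
  shows "((\<lambda>t. F (r * cis t)) has_integral 2 * pi * F 0) {0..2 * pi}"
  using Cauchy_integral_circle[of F r 0] assms by simp

lemma Fourier_coefficient_circle:
  fixes F :: "complex \<Rightarrow> complex" and k :: nat
  assumes "F holomorphic_on cball 0 r" "0 < r"
  shows "((\<lambda>t. F (r * cis t) * cis (- (k * t))) has_integral
      2 * pi * r ^ k * ((deriv ^^ k) F 0 / fact k)) {0..2 * pi}"
proof -
  have "((\<lambda>u. F u / (u - 0) ^ Suc k) has_contour_integral 2 * pi * \<i> / fact k * (deriv ^^ k) F 0)
      (circlepath 0 r)"
    by (rule Cauchy_has_contour_integral_higher_derivative_circlepath)
      (use assms in \<open>auto intro: holomorphic_on_imp_continuous_on holomorphic_on_subset\<close>)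
  from has_integral_mult_right[OF has_integral_circle[OF this], of "of_real r ^ k"]
  have "((\<lambda>t. of_real r ^ k * (F (r * cis t) / (r * cis t) ^ Suc k * (r * cis t))) has_integral
      2 * pi * r ^ k * ((deriv ^^ k) F 0 / fact k)) {0..2 * pi}"
    by (simp add: mult_ac)
  moreover have "of_real r ^ k * (F (r * cis t) / (r * cis t) ^ Suc k * (r * cis t)) =
      F (r * cis t) * cis (- (k * t))" for t :: real
  proof -
    have "(of_real r * cis t) ^ k = of_real r ^ k * cis (k * t)"
      by (simp add: power_mult_distrib Complex.DeMoivre)
    thus ?thesis using assms(2) by (simp add: field_simps cis_mult)
  qed
  ultimately show ?thesis by simp
qed

lemma negative_Fourier_coefficient_circle:
  fixes F :: "complex \<Rightarrow> complex" and k :: nat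
  assumes "F holomorphic_on cball 0 r" "0 < r" "0 < k"
  shows "((\<lambda>t. F (r * cis t) * cis (k * t)) has_integral 0) {0..2 * pi}"
proof -
  have "((\<lambda>t. (of_real r * cis t) ^ k * F (r * cis t)) has_integral 0) {0..2 * pi}"
    using mean_value_circle[of "\<lambda>z. z ^ k * F z" r] assms
    by (simp add: zero_power holomorphic_intros)
  from has_integral_mult_right[OF this, of "1 / of_real r ^ k"] show ?thesis
    using assms(2) by (simp add: power_mult_distrib Complex.DeMoivre field_simps)
qed

text \<open>
  The Poisson kernel is the Cauchy kernel \<open>\<zeta> / (\<zeta> - w)\<close> plus \<open>cnj w * \<zeta> / (r\<^sup>2 - cnj w * \<zeta>)\<close>. The second summand is
  holomorphic in \<open>\<zeta>\<close> on the closed disk and vanishes at 0, so it does not change the integral against a holomorphic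
  function; on the circle the sum is real and nonnegative.
\<close>
lemma Poisson_circle:
  fixes F :: "complex \<Rightarrow> complex"
  assumes F: "F holomorphic_on cball 0 r" and w: "norm w < r"
  shows "((\<lambda>t. F (r * cis t) * of_real ((r\<^sup>2 - (norm w)\<^sup>2) / (norm (r * cis t - w))\<^sup>2))
    has_integral 2 * pi * F w) {0..2 * pi}"
proof -
  have "0 < r" using w norm_ge_zero[of w] by linarith
  have nz: "of_real (r\<^sup>2) - cnj w * u \<noteq> 0" if "u \<in> cball 0 r" for u
  proof
    assume "of_real (r\<^sup>2) - cnj w * u = 0"
    hence "norm (of_real (r\<^sup>2) :: complex) = norm w * norm u"
      by (metis complex_mod_cnj eq_iff_diff_eq_0 norm_mult of_real_power)
    also have "\<dots> \<le> norm w * r" using that by (intro mult_left_mono) auto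
    also have "\<dots> < r * r" using w \<open>0 < r\<close> by simp
    finally show False by (simp add: power2_eq_square norm_mult del: of_real_power of_real_mult)
  qed
  have "(\<lambda>u. F u * (cnj w * u / (of_real (r\<^sup>2) - cnj w * u))) holomorphic_on cball 0 r"
    using nz by (intro holomorphic_intros F) auto
  from mean_value_circle[OF this \<open>0 < r\<close>]
  have "((\<lambda>t. F (r * cis t) * (cnj w * (r * cis t) / (of_real (r\<^sup>2) - cnj w * (r * cis t)))) has_integral 0) {0..2 * pi}"
    by simp
  from has_integral_add[OF Cauchy_integral_circle[OF F w] this]
  have "((\<lambda>t. F (r * cis t) * (r * cis t / (r * cis t - w) +
      cnj w * (r * cis t) / (of_real (r\<^sup>2) - cnj w * (r * cis t)))) has_integral 2 * pi * F w) {0..2 * pi}"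
    by (simp add: algebra_simps)
  moreover have "r * cis t / (r * cis t - w) + cnj w * (r * cis t) / (of_real (r\<^sup>2) - cnj w * (r * cis t)) =
      of_real ((r\<^sup>2 - (norm w)\<^sup>2) / (norm (r * cis t - w))\<^sup>2)" for t
  proof -
    define z where "z = r * cis t"
    have zz: "of_real (r\<^sup>2) = z * cnj z"
      by (simp add: z_def cis_cnj cis_mult power2_eq_square)
    have nz0: "z \<noteq> 0" using \<open>0 < r\<close> by (simp add: z_def)
    have "norm z = r" using \<open>0 < r\<close> by (simp add: z_def norm_mult)
    hence nz1: "z - w \<noteq> 0" using w by auto
    hence nz2: "cnj z - cnj w \<noteq> 0" by (metis complex_cnj_diff complex_cnj_zero_iff)
    have "cnj w * z / (of_real (r\<^sup>2) - cnj w * z) = cnj w / (cnj z - cnj w)"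
      using nz0 nz2 zz by (simp add: field_simps)
    moreover have "of_real ((r\<^sup>2 - (norm w)\<^sup>2) / (norm (z - w))\<^sup>2) =
        (z * cnj z - w * cnj w) / ((z - w) * (cnj z - cnj w))"
      by (simp only: of_real_divide of_real_diff zz complex_norm_square complex_cnj_diff)
    moreover have "z / (z - w) + cnj w / (cnj z - cnj w) =
        (z * cnj z - w * cnj w) / ((z - w) * (cnj z - cnj w))"
      using nz1 nz2 by (simp add: divide_simps) (simp add: algebra_simps)
    ultimately show ?thesis unfolding z_def by simp
  qed
  ultimately show ?thesis by simp
qed

lemma Poisson_kernel_le:
  assumes "norm w < r"
  shows "(r\<^sup>2 - (norm w)\<^sup>2) / (norm (r * cis t - w))\<^sup>2 \<le> (r + norm w) / (r - norm w)"
    and "0 \<le> (r\<^sup>2 - (norm w)\<^sup>2) / (norm (r * cis t - w))\<^sup>2"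
proof -
  have r: "0 < r" using assms norm_ge_zero[of w] by linarith
  have "r - norm w \<le> norm (r * cis t - w)"
    using norm_triangle_ineq2[of "r * cis t" w] r by (simp add: norm_mult)
  hence pos: "0 < norm (r * cis t - w)" and "(r - norm w)\<^sup>2 \<le> (norm (r * cis t - w))\<^sup>2" using assms by (auto intro: power_mono simp del: zero_less_norm_iff)
  moreover have "0 \<le> r\<^sup>2 - (norm w)\<^sup>2" using assms by (simp add: power_mono)
  ultimately have "(r\<^sup>2 - (norm w)\<^sup>2) / (norm (r * cis t - w))\<^sup>2 \<le> (r\<^sup>2 - (norm w)\<^sup>2) / (r - norm w)\<^sup>2"
    using assms pos by (intro divide_left_mono mult_pos_pos zero_less_power) auto
  also have "\<dots> = (r + norm w) * (r - norm w) / (r - norm w)\<^sup>2"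
    by (simp add: power2_eq_square algebra_simps)
  also have "\<dots> = (r + norm w) / (r - norm w)"
    using assms by (simp add: power2_eq_square)
  finally show "(r\<^sup>2 - (norm w)\<^sup>2) / (norm (r * cis t - w))\<^sup>2 \<le> (r + norm w) / (r - norm w)" .
  show "0 \<le> (r\<^sup>2 - (norm w)\<^sup>2) / (norm (r * cis t - w))\<^sup>2"
    using \<open>0 \<le> r\<^sup>2 - (norm w)\<^sup>2\<close> by simp
qed

section \<open>Holomorphic functions on the disk\<close>

text \<open>
  The maximum principle for a real part that extends continuously to the closed disk although \<open>G\<close> itself may not:
  by uniform continuity the bound holds up to \<open>e\<close> on circles close to the boundary.
\<close>
lemma Re_le_from_boundary:
  fixes u :: "complex \<Rightarrow> real"
  assumes G: "G holomorphic_on unit_disk"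
    and u: "continuous_on (cball 0 1) u" "\<And>z. z \<in> unit_disk \<Longrightarrow> u z = Re (G z)"
    and bound: "\<And>z. norm z = 1 \<Longrightarrow> u z \<le> M"
    and z: "z \<in> unit_disk"
  shows "u z \<le> M"
proof (rule field_le_epsilon)
  fix e :: real assume "e > 0"
  obtain \<delta> where \<delta>: "\<delta> > 0"
      "\<And>x y. x \<in> cball 0 1 \<Longrightarrow> y \<in> cball 0 1 \<Longrightarrow> dist x y < \<delta> \<Longrightarrow> dist (u x) (u y) < e"
    using compact_uniformly_continuous[OF u(1) compact_cball] \<open>e > 0\<close>
    unfolding uniformly_continuous_on_def by metis
  obtain \<rho> where \<rho>: "max (norm z) (max 0 (1 - \<delta>)) < \<rho>" "\<rho> < 1"
    using dense[of "max (norm z) (max 0 (1 - \<delta>))" 1] z \<delta>(1) by auto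
  have "Re (G z) \<le> M + e"
  proof (rule maximum_real_frontier[of G "ball 0 \<rho>"])
    show "G holomorphic_on interior (ball 0 \<rho>)"
      using \<rho> by (intro holomorphic_on_subset[OF G]) auto
    show "continuous_on (closure (ball 0 \<rho>)) G"
      using \<rho> by (intro continuous_on_subset[OF holomorphic_on_imp_continuous_on[OF G]]) auto
    show "z \<in> ball 0 \<rho>" using \<rho> by simp
    fix y :: complex assume "y \<in> frontier (ball 0 \<rho>)"
    hence y: "norm y = \<rho>" using \<rho> by auto
    have "dist y (y /\<^sub>R \<rho>) = \<bar>1 - inverse \<rho>\<bar> * norm y"
      by (metis dist_norm norm_scaleR scaleR_left.diff scaleR_one)
    also have "\<dots> = 1 - \<rho>" using \<rho> y by (simp add: abs_if field_simps)
    finally have "dist (u y) (u (y /\<^sub>R \<rho>)) < e"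
      using \<rho> y by (intro \<delta>(2)) auto
    moreover have "u (y /\<^sub>R \<rho>) \<le> M" using \<rho> y by (intro bound) simp
    moreover have "u y = Re (G y)" using \<rho> y by (intro u(2)) simp
    ultimately show "Re (G y) \<le> M + e" by (simp add: dist_real_def)
  qed simp
  thus "u z \<le> M + e" using u(2)[OF z] by simp
qed

lemma Im_zero_imp_constant:
  assumes "A holomorphic_on unit_disk" "\<And>z. z \<in> unit_disk \<Longrightarrow> Im (A z) = 0" "w \<in> unit_disk"
  shows "A w = A 0"
proof (rule ccontr)
  assume "A w \<noteq> A 0"
  hence "\<not> A constant_on unit_disk" using assms(3) by (force simp: constant_on_def)
  hence "open (A ` unit_disk)" using assms(1) by (intro open_mapping_thm[of A unit_disk]) auto
  then obtain e where e: "e > 0" "ball (A w) e \<subseteq> A ` unit_disk"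
    using assms(3) unfolding open_contains_ball by blast
  have "A w + \<i> * of_real (e / 2) \<in> ball (A w) e" using e(1) by (simp add: dist_norm norm_mult)
  then obtain z where z: "z \<in> unit_disk" "A w + \<i> * of_real (e / 2) = A z" using e(2) by blast
  have "Im (A z) = e / 2" using assms(2)[OF assms(3)] by (simp flip: z(2))
  with assms(2)[OF z(1)] e(1) show False by simp
qed

lemma Re_pos_if_Re_nonneg:
  assumes "B holomorphic_on unit_disk" "\<And>z. z \<in> unit_disk \<Longrightarrow> Re (B z) \<ge> 0" "Re (B 0) > 0"
    and "w \<in> unit_disk"
  shows "Re (B w) > 0"
proof (rule ccontr)
  assume "\<not> Re (B w) > 0"
  hence Bw: "Re (B w) = 0" using assms(2)[OF assms(4)] by simp
  hence "\<not> B constant_on unit_disk" using assms(3,4) by (force simp: constant_on_def)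
  hence "open (B ` unit_disk)" using assms(1) by (intro open_mapping_thm[of B unit_disk]) auto
  then obtain e where e: "e > 0" "ball (B w) e \<subseteq> B ` unit_disk"
    using assms(4) unfolding open_contains_ball by blast
  have "B w - of_real (e / 2) \<in> ball (B w) e" using e(1) by (simp add: dist_norm)
  then obtain z where z: "z \<in> unit_disk" "B w - of_real (e / 2) = B z" using e(2) by blast
  have "Re (B z) = - e / 2" using Bw by (simp flip: z(2))
  with assms(2)[OF z(1)] e(1) show False by simp
qed

text \<open>
  The difference of the two decompositions gives holomorphic functions with \<open>A = cnj B\<close>; then \<open>A + B\<close> and
  \<open>\<i> * (A - B)\<close> are real-valued, hence constant.
\<close>
lemma harmonic_parts_unique:
  assumes hol: "g1 holomorphic_on unit_disk" "h1 holomorphic_on unit_disk"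
      "g2 holomorphic_on unit_disk" "h2 holomorphic_on unit_disk"
    and eq: "\<And>w. w \<in> unit_disk \<Longrightarrow> g1 w + cnj (h1 w) = g2 w + cnj (h2 w)"
    and w: "w \<in> unit_disk"
  shows "deriv g1 w = deriv g2 w" "deriv h1 w = deriv h2 w"
proof -
  define A B where "A = (\<lambda>w. g1 w - g2 w)" and "B = (\<lambda>w. h2 w - h1 w)"
  have AB: "A w = cnj (B w)" if "w \<in> unit_disk" for w
    using eq[OF that] by (simp add: A_def B_def algebra_simps)
  have holAB: "A holomorphic_on unit_disk" "B holomorphic_on unit_disk"
    unfolding A_def B_def by (intro holomorphic_intros hol)+
  have const: "A w = A 0 \<and> B w = B 0" if w: "w \<in> unit_disk" for w
  proof -
    have "A w + B w = A 0 + B 0"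
      by (rule Im_zero_imp_constant[OF _ _ w]) (auto intro!: holomorphic_intros holAB simp: AB)
    moreover have "\<i> * (A w - B w) = \<i> * (A 0 - B 0)"
      by (rule Im_zero_imp_constant[OF _ _ w]) (auto intro!: holomorphic_intros holAB simp: AB)
    ultimately show ?thesis by (simp add: complex_eq_iff)
  qed
  have zero_deriv: "(F has_field_derivative 0) (at w)" if "\<And>v. v \<in> unit_disk \<Longrightarrow> F 0 = F v" for F
    by (rule has_field_derivative_transform_within_open[OF DERIV_const[of "F 0"] open_ball w that])
  have "(A has_field_derivative 0) (at w)" "(B has_field_derivative 0) (at w)"
    by (rule zero_deriv; metis const)+
  hence "deriv A w = 0" "deriv B w = 0" by (auto intro: DERIV_imp_deriv)
  moreover have "deriv A w = deriv g1 w - deriv g2 w" "deriv B w = deriv h2 w - deriv h1 w"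
    unfolding A_def B_def
    by (intro deriv_diff holomorphic_on_imp_differentiable_at[OF _ open_ball w] hol)+
  ultimately show "deriv g1 w = deriv g2 w" "deriv h1 w = deriv h2 w" by simp_all
qed

lemma zero_of_order_ge_2I:
  assumes k: "k holomorphic_on unit_disk" and F: "\<And>z. z \<in> unit_disk \<Longrightarrow> F z = z\<^sup>2 * k z"
  shows "zero_of_order_ge 2 F"
proof (cases "\<forall>z\<in>unit_disk. k z = 0")
  case True
  thus ?thesis unfolding zero_of_order_ge_def using F by simp
next
  case False
  then obtain b where b: "b \<in> unit_disk" "k b \<noteq> 0" by blast
  define n p where "n = zorder k 0" and "p = zor_poly k 0"
  obtain r where n: "n \<ge> 0" and r: "r > 0" "cball 0 r \<subseteq> unit_disk" "p holomorphic_on cball 0 r"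
      "\<And>w. w \<in> cball 0 r \<Longrightarrow> k w = p w * w ^ nat n \<and> p w \<noteq> 0"
  proof -
    have zorder: "(if k 0 = 0 then n > 0 else n = 0) \<and> (\<exists>r>0. cball 0 r \<subseteq> unit_disk \<and> p holomorphic_on cball 0 r \<and>
        (\<forall>w\<in>cball 0 r. k w = p w * (w - 0) ^ nat n \<and> p w \<noteq> 0))"
      unfolding n_def p_def by (rule zorder_exist_zero[OF k open_ball]) (use b in auto)
    hence "n \<ge> 0" by (auto split: if_splits)
    with zorder show ?thesis using that unfolding diff_zero by blast
  qed
  have "zorder F 0 = int (nat n + 2)"
  proof (rule zorder_eqI[of "ball 0 r"])
    show "p holomorphic_on ball 0 r" using r(3) by (rule holomorphic_on_subset) auto
    show "F w = p w * (w - 0) powi int (nat n + 2)" if "w \<in> ball 0 r" for w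
    proof -
      have "w \<in> unit_disk" "k w = p w * w ^ nat n" using that r(4)[of w] subsetD[OF r(2), of w] by auto
      thus ?thesis using F[of w] unfolding power_int_of_nat by (simp add: power_add power2_eq_square)
    qed
  qed (use r in auto)
  thus ?thesis using n by (simp add: zero_of_order_ge_def)
qed

section \<open>Perimeter and Taylor coefficients\<close>

locale harmonic_disk_map =
  fixes f g h :: "complex \<Rightarrow> complex"
  assumes f_cont: "continuous_on (cball 0 1) f"
    and g_hol: "g holomorphic_on unit_disk"
    and h_hol: "h holomorphic_on unit_disk"
    and f_eq: "\<And>z. z \<in> unit_disk \<Longrightarrow> f z = g z + cnj (h z)"

begin

lemma derivs_holomorphic: "deriv g holomorphic_on unit_disk" "deriv h holomorphic_on unit_disk"
  using g_hol h_hol by (auto intro: holomorphic_deriv)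

lemma derivs_holomorphic_cball:
  assumes "r < 1"
  shows "deriv g holomorphic_on cball 0 r" "deriv h holomorphic_on cball 0 r"
  by (rule holomorphic_on_subset[OF derivs_holomorphic(1)] holomorphic_on_subset[OF derivs_holomorphic(2)];
      use assms in auto)+

lemma circle_velocity:
  fixes r :: real
  assumes "0 \<le> r" "r < 1"
  defines "z \<equiv> \<lambda>t. r * cis t"
  shows "((\<lambda>t. f (z t)) has_vector_derivative
    \<i> * (z t * deriv g (z t) - cnj (z t * deriv h (z t)))) (at t within S)"
proof -
  have z: "z t \<in> unit_disk" for t using assms by (simp add: z_def norm_mult)
  have z': "(z has_vector_derivative \<i> * z t) (at t within S)" for t
    unfolding z_def
    by (auto intro!: derivative_eq_intros simp: has_vector_derivative_def scaleR_conv_of_real)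
  have deriv: "(F has_field_derivative deriv F (z t)) (at (z t))" if "F holomorphic_on unit_disk" for F
    using holomorphic_derivI[OF that _ z] by simp
  have comp: "((\<lambda>t. F (z t)) has_vector_derivative \<i> * z t * deriv F (z t)) (at t within S)"
    if "F holomorphic_on unit_disk" for F
    using field_vector_diff_chain_within[OF z'[of t] has_field_derivative_at_within[OF deriv[OF that]]]
    by (simp add: o_def)
  have "((\<lambda>t. cnj (h (z t))) has_vector_derivative cnj (\<i> * z t * deriv h (z t))) (at t within S)"
    by (rule bounded_linear.has_vector_derivative[OF bounded_linear_cnj comp[OF h_hol]])
  from has_vector_derivative_add[OF comp[OF g_hol] this]
  show ?thesis using f_eq[OF z] by (simp add: algebra_simps)
qed

end

locale bounded_perimeter = harmonic_disk_map +
  fixes M :: real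
  assumes perimeter_le: "\<And>x. x \<in> polygonal_sums (\<lambda>t. f (cis t)) 0 (2 * pi) \<Longrightarrow> x \<le> M"

begin

text \<open>
  For fixed angles \<open>s i\<close>, the length of the polygon with vertices \<open>f (z * cis (s i))\<close> is a subharmonic function of
  \<open>z\<close>, bounded by \<open>M\<close> on the unit circle. Subharmonicity is used in the form that, at the given point, the
  length equals the real part of a sum with fixed coefficients \<open>c i\<close>, which is harmonic in \<open>z\<close> and
  nowhere larger than the length.
\<close>
lemma inner_circle_perimeter_le:
  fixes r :: real
  assumes r: "0 \<le> r" "r < 1"
    and x: "x \<in> polygonal_sums (\<lambda>t. f (r * cis t)) 0 (2 * pi)"
  shows "x \<le> M"
proof -
  obtain n s where s: "x = (\<Sum>i<n. dist (f (r * cis (s i))) (f (r * cis (s (Suc i)))))"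
      "s 0 = 0" "s n = 2 * pi" "\<And>i. i < n \<Longrightarrow> s i \<le> s (Suc i)"
    using x by (elim polygonal_sumsE) blast
  define D where "D = (\<lambda>i z. f (z * cis (s i)) - f (z * cis (s (Suc i))))"
  define c where "c = (\<lambda>i. cnj (sgn (D i (of_real r))))"
  define u where "u = (\<lambda>z. Re (\<Sum>i<n. c i * D i z))"
  define G where "G = (\<lambda>z. \<Sum>i<n. c i * (g (z * cis (s i)) - g (z * cis (s (Suc i)))) +
      cnj (c i) * (h (z * cis (s i)) - h (z * cis (s (Suc i)))))"
  have rotate: "(\<lambda>z. F (z * cis t)) holomorphic_on unit_disk" if "F holomorphic_on unit_disk" for F t
  proof -
    have "F \<circ> (\<lambda>z. z * cis t) holomorphic_on unit_disk"
      by (rule holomorphic_on_compose_gen[OF _ that]) (auto simp: norm_mult intro: holomorphic_intros)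
    thus ?thesis by (simp add: o_def)
  qed
  have c: "norm (c i) \<le> 1" for i by (simp add: c_def norm_sgn)
  \<comment> \<open>harmonicity turns the conjugate of h into h, with conjugated coefficient\<close>
  have "u (of_real r) \<le> M"
  proof (rule Re_le_from_boundary)
    show "G holomorphic_on unit_disk"
      unfolding G_def by (intro holomorphic_intros rotate g_hol h_hol)
    show "continuous_on (cball 0 1) u"
      unfolding u_def D_def
      by (intro continuous_intros continuous_on_compose2[OF f_cont]) (auto simp: norm_mult)
    show "of_real r \<in> unit_disk" using r by simp
  next
    fix z assume z: "z \<in> unit_disk"
    have "Re (c i * D i z) = Re (c i * (g (z * cis (s i)) - g (z * cis (s (Suc i)))) +
      cnj (c i) * (h (z * cis (s i)) - h (z * cis (s (Suc i)))))" for i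
      using z by (simp add: D_def f_eq norm_mult algebra_simps)
    thus "u z = Re (G z)" by (simp add: u_def G_def)
  next
    fix z :: complex assume "norm z = 1"
    then obtain \<alpha> where \<alpha>: "z = cis \<alpha>"
      by (metis cis_Arg norm_zero sgn_eq zero_neq_one div_by_1 of_real_1)
    have "u z \<le> (\<Sum>i<n. norm (c i * D i z))"
      unfolding u_def by (rule order_trans[OF complex_Re_le_cmod norm_sum])
    also have "\<dots> \<le> (\<Sum>i<n. norm (D i z))"
      using c by (intro sum_mono) (simp add: norm_mult mult_left_le_one_le)
    also have "\<dots> = (\<Sum>i<n. dist (f (cis (\<alpha> + s i))) (f (cis (\<alpha> + s (Suc i)))))"
      by (simp add: D_def \<alpha> cis_mult dist_norm)
    also have "\<dots> \<le> M"
      by (rule polygonal_sums_circle_base_point[OF perimeter_le, where c = \<alpha>])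
        (use s in \<open>auto simp: polygonal_sums_def intro!: exI[of _ n] exI[of _ "\<lambda>i. \<alpha> + s i"]\<close>)
    finally show "u z \<le> M" .
  qed
  moreover have "u (of_real r) = x"
  proof -
    have "c i * D i (of_real r) = of_real (norm (D i (of_real r)))" for i
      by (simp add: c_def sgn_eq) (simp add: complex_norm_square[symmetric] mult.commute power2_eq_square)
    hence "Re (c i * D i (of_real r)) = norm (D i (of_real r))" for i by simp
    thus ?thesis unfolding u_def s(1) Re_sum by (simp add: D_def dist_norm)
  qed
  ultimately show ?thesis by simp
qed

lemma speed_integral_le:
  fixes r :: real
  assumes r: "0 < r" "r < 1"
  defines "z \<equiv> \<lambda>t. r * cis t"
  shows "integral {0..2 * pi} (\<lambda>t. norm (z t * deriv g (z t) - cnj (z t * deriv h (z t)))) \<le> M"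
proof -
  have "continuous_on {0..2 * pi} (\<lambda>t. \<i> * (z t * deriv g (z t) - cnj (z t * deriv h (z t))))"
    using r unfolding z_def
    by (intro continuous_intros continuous_on_compose2[OF holomorphic_on_imp_continuous_on[OF derivs_holomorphic(1)]]
        continuous_on_compose2[OF holomorphic_on_imp_continuous_on[OF derivs_holomorphic(2)]])
      (auto simp: norm_mult)
  from integral_speed_le[OF _ circle_velocity this[unfolded z_def] inner_circle_perimeter_le[of r]] r
  have "integral {0..2 * pi} (\<lambda>t. norm (\<i> * (z t * deriv g (z t) - cnj (z t * deriv h (z t))))) \<le> M"
    unfolding z_def by simp
  thus ?thesis by (simp only: norm_mult norm_ii mult_1)
qed

lemma perimeter_nonneg: "0 \<le> M"
proof -
  have "(\<Sum>i<1. dist (f (cis (2 * pi * real i))) (f (cis (2 * pi * real (Suc i))))) \<in>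
      polygonal_sums (\<lambda>t. f (cis t)) 0 (2 * pi)"
    unfolding polygonal_sums_def
    by (auto intro!: exI[of _ "1::nat"] exI[of _ "\<lambda>i. 2 * pi * real i"])
  from perimeter_le[OF this] show ?thesis by simp
qed

text \<open>
  The coefficient of \<open>g\<close> of index \<open>Suc m\<close> is, up to constants, the Fourier coefficient of the same index of the
  velocity; its antiholomorphic part is orthogonal to \<open>cis (Suc m * t)\<close>.
\<close>
lemma coefficient_le: "2 * pi * norm ((deriv ^^ Suc m) g 0 / fact m) \<le> M"
proof -
  define C where "C = (deriv ^^ Suc m) g 0 / fact m"
  have C: "C = (deriv ^^ m) (deriv g) 0 / fact m" unfolding C_def funpow_Suc_right by simp
  have "2 * pi * norm C * r ^ Suc m \<le> M" if r: "0 < r" "r < 1" for r :: real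
  proof -
    define z where "z = (\<lambda>t. of_real r * cis t)"
    let ?v = "\<lambda>t. z t * deriv g (z t) - cnj (z t * deriv h (z t))"
    have g_part: "((\<lambda>t. deriv g (z t) * cis (- (m * t))) has_integral 2 * pi * r ^ m * C) {0..2 * pi}"
      unfolding z_def C
      by (rule Fourier_coefficient_circle[OF derivs_holomorphic_cball(1)]) (use r in auto)
    have h_part: "((\<lambda>t. cnj (deriv h (z t) * cis (Suc (Suc m) * t))) has_integral cnj 0) {0..2 * pi}"
      using has_integral_linear[OF negative_Fourier_coefficient_circle[OF
            derivs_holomorphic_cball(2)[OF r(2)] r(1), of "Suc (Suc m)"] bounded_linear_cnj]
      unfolding z_def o_def by simp
    have "((\<lambda>t. of_real r * (deriv g (z t) * cis (- (m * t)) - cnj (deriv h (z t) * cis (Suc (Suc m) * t))))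
        has_integral of_real r * (2 * pi * r ^ m * C - cnj 0)) {0..2 * pi}"
      by (rule has_integral_mult_right[OF has_integral_diff[OF g_part h_part]])
    moreover have "of_real r * (deriv g (z t) * cis (- (m * t)) - cnj (deriv h (z t) * cis (Suc (Suc m) * t))) =
        ?v t * cis (- (Suc m * t))" for t :: real
    proof -
      have rotations: "cis (- (m * t)) = cis t * cis (- (Suc m * t))"
        "cis (- (Suc (Suc m) * t)) = cis (- t) * cis (- (Suc m * t))"
        unfolding cis_mult by (rule arg_cong[of _ _ cis], simp add: algebra_simps)+
      show ?thesis unfolding z_def complex_cnj_mult cis_cnj complex_cnj_complex_of_real rotations
        by (simp only: right_diff_distrib left_diff_distrib mult_ac)
    qed
    ultimately have int: "((\<lambda>t. ?v t * cis (- (Suc m * t))) has_integral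
        of_real r * (2 * pi * r ^ m * C)) {0..2 * pi}" by simp
    have "continuous_on {0..2 * pi} (\<lambda>t. norm (?v t))"
      using r unfolding z_def
      by (intro continuous_intros
          continuous_on_compose2[OF holomorphic_on_imp_continuous_on[OF derivs_holomorphic(1)]]
          continuous_on_compose2[OF holomorphic_on_imp_continuous_on[OF derivs_holomorphic(2)]])
        (auto simp: norm_mult)
    hence "norm (integral {0..2 * pi} (\<lambda>t. ?v t * cis (- (Suc m * t)))) \<le>
        integral {0..2 * pi} (\<lambda>t. norm (?v t))"
      by (intro integral_norm_bound_integral has_integral_integrable[OF int] integrable_continuous_interval)
        (auto simp: norm_mult)
    also have "\<dots> \<le> M" unfolding z_def by (rule speed_integral_le[OF r])
    finally show ?thesis
      using r unfolding integral_unique[OF int] by (simp add: norm_mult norm_power mult_ac)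
  qed
  hence "eventually (\<lambda>r. 2 * pi * norm C * r ^ Suc m \<le> M) (at_left 1)"
    unfolding eventually_at_left[OF zero_less_one] by (auto intro: exI[of _ 0])
  moreover have "((\<lambda>r. 2 * pi * norm C * r ^ Suc m) \<longlongrightarrow> 2 * pi * norm C * 1 ^ Suc m) (at_left 1)"
    by (intro tendsto_intros)
  ultimately have "2 * pi * norm C * 1 ^ Suc m \<le> M"
    by (intro tendsto_upperbound) auto
  thus ?thesis by (simp add: C_def)
qed

end

section \<open>Equality forces positivity\<close>

context bounded_perimeter
begin

text \<open>
  The two quantitative steps of the equality case, at a fixed radius. The defect \<open>d = norm q - Re q\<close> is nonnegative
  with integral at most \<open>2 * pi * a * (1 / r - 1)\<close>; it dominates the negative part of \<open>Re q\<close>, and \<open>(Im q)\<^sup>2\<close> is the product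
  of \<open>d\<close> and \<open>norm q + Re q\<close>. The Poisson kernel is at most \<open>C\<close>.
\<close>
lemma extremal_defect:
  fixes a r :: real
  assumes a: "deriv g 0 = of_real a" "M \<le> 2 * pi * a" and r: "0 < r" "r < 1" and w: "norm w < r"
  defines "C \<equiv> (r + norm w) / (r - norm w)"
  shows "Re (deriv g w - w\<^sup>2 * deriv h w / (of_real r)\<^sup>2) \<ge> - C * a * (1 / r - 1)"
    and "\<bar>Im (deriv g w + w\<^sup>2 * deriv h w / (of_real r)\<^sup>2)\<bar> \<le> C * a * sqrt (1 / r - 1) * (1 / 2 + 1 / r)"
proof -
  define z where "z = (\<lambda>t. of_real r * cis t)"
  define q where "q = (\<lambda>t. deriv g (z t) - cnj ((z t)\<^sup>2 * deriv h (z t)) / (of_real r)\<^sup>2)"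
  define d where "d = (\<lambda>t. norm (q t) - Re (q t))"
  define P where "P = (\<lambda>t. (r\<^sup>2 - (norm w)\<^sup>2) / (norm (z t - w))\<^sup>2)"
  define B1 where "B1 = (\<lambda>z. deriv g z - z\<^sup>2 * deriv h z / (of_real r)\<^sup>2)"
  define B2 where "B2 = (\<lambda>z. deriv g z + z\<^sup>2 * deriv h z / (of_real r)\<^sup>2)"
  have P: "0 \<le> P t" "P t \<le> C" for t
    using Poisson_kernel_le[OF w] unfolding P_def z_def C_def by auto
  have "C \<ge> 0" using P order_trans by blast
  have cont: "continuous_on {0..2 * pi} q"
    using r unfolding z_def q_def
    by (intro continuous_intros
        continuous_on_compose2[OF holomorphic_on_imp_continuous_on[OF derivs_holomorphic(1)]]
        continuous_on_compose2[OF holomorphic_on_imp_continuous_on[OF derivs_holomorphic(2)]])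
      (auto simp: norm_mult)
  have "((\<lambda>t. (z t)\<^sup>2 * deriv h (z t)) has_integral 0) {0..2 * pi}"
    using mean_value_circle[of "\<lambda>z. z\<^sup>2 * deriv h z" r] derivs_holomorphic_cball[OF r(2)] r(1)
    unfolding z_def by (simp add: holomorphic_intros)
  hence "((\<lambda>t. cnj ((z t)\<^sup>2 * deriv h (z t))) has_integral cnj 0) {0..2 * pi}"
    by (rule has_integral_linear[OF _ bounded_linear_cnj, unfolded o_def])
  from has_integral_diff[OF mean_value_circle[OF derivs_holomorphic_cball(1)[OF r(2)] r(1)]
      has_integral_divide[OF this, of "(of_real r)\<^sup>2"]]
  have "(q has_integral 2 * pi * a) {0..2 * pi}"
    unfolding q_def z_def a(1) by simp
  from has_integral_Re[OF this] have Re_q: "((\<lambda>t. Re (q t)) has_integral 2 * pi * a) {0..2 * pi}"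
    by simp
  have norm_int: "(\<lambda>t. norm (q t)) integrable_on {0..2 * pi}"
    by (intro integrable_continuous_interval continuous_intros cont)
  define I where "I = integral {0..2 * pi} (\<lambda>t. norm (q t))"
  have norm_q: "((\<lambda>t. norm (q t)) has_integral I) {0..2 * pi}"
    using norm_int unfolding I_def by (rule integrable_integral)
  have "r * norm (q t) = norm (z t * deriv g (z t) - cnj (z t * deriv h (z t)))" for t
  proof -
    have "z t * cnj (z t) = (of_real r)\<^sup>2" by (simp add: z_def cis_cnj cis_mult power2_eq_square)
    hence "z t * q t = z t * deriv g (z t) - cnj (z t * deriv h (z t))"
      using r by (simp add: q_def right_diff_distrib power2_eq_square) (simp add: z_def)
    moreover have "norm (z t * q t) = r * norm (q t)" using r by (simp add: z_def norm_mult)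
    ultimately show ?thesis by simp
  qed
  hence "r * I \<le> M"
    using speed_integral_le[OF r] unfolding I_def z_def by (simp flip: integral_mult_right)
  hence I_le: "I \<le> 2 * pi * a / r" using a(2) r(1) by (simp add: field_simps)
  have d: "(d has_integral (I - 2 * pi * a)) {0..2 * pi}"
    unfolding d_def by (rule has_integral_diff[OF norm_q Re_q])
  have d_le: "I - 2 * pi * a \<le> 2 * pi * a * (1 / r - 1)"
    using I_le by (simp add: algebra_simps)
  have d_nonneg: "0 \<le> d t" for t unfolding d_def using complex_Re_le_cmod by simp
  have hol: "B1 holomorphic_on cball 0 r" "B2 holomorphic_on cball 0 r"
    unfolding B1_def B2_def using derivs_holomorphic_cball[OF r(2)] r
    by (auto intro!: holomorphic_intros)
  have "Re (x - y / (of_real r)\<^sup>2) = Re (x - cnj y / (of_real r)\<^sup>2)"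
    "Im (x + y / (of_real r)\<^sup>2) = Im (x - cnj y / (of_real r)\<^sup>2)" for x y :: complex
    by (simp_all add: Re_divide_of_real Im_divide_of_real flip: of_real_power)
  hence B: "Re (B1 (z t)) = Re (q t)" "Im (B2 (z t)) = Im (q t)" for t
    unfolding B1_def B2_def q_def by blast+
  have "((\<lambda>t. Re (B1 (z t) * of_real (P t))) has_integral Re (2 * pi * B1 w)) {0..2 * pi}"
    unfolding P_def z_def by (rule has_integral_Re[OF Poisson_circle[OF hol(1) w]])
  hence Re_int: "((\<lambda>t. Re (q t) * P t) has_integral 2 * pi * Re (B1 w)) {0..2 * pi}"
    by (simp add: B)
  have d_int: "((\<lambda>t. - C * d t) has_integral (- C * (I - 2 * pi * a))) {0..2 * pi}"
    by (rule has_integral_mult_right[OF d])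
  have "- C * d t \<le> Re (q t) * P t" for t
  proof -
    have "d t * P t \<le> d t * C" using P d_nonneg by (intro mult_left_mono) auto
    moreover have "- d t * P t \<le> Re (q t) * P t"
      using P by (intro mult_right_mono) (auto simp: d_def)
    ultimately show ?thesis by (simp add: mult.commute)
  qed
  hence "- C * (I - 2 * pi * a) \<le> 2 * pi * Re (B1 w)" by (rule has_integral_le[OF d_int Re_int])
  moreover have "C * (I - 2 * pi * a) \<le> C * (2 * pi * a * (1 / r - 1))"
    using d_le \<open>C \<ge> 0\<close> by (rule mult_left_mono)
  ultimately have "2 * pi * (- C * a * (1 / r - 1)) \<le> 2 * pi * Re (B1 w)"
    by (simp add: mult_ac)
  thus "Re (deriv g w - w\<^sup>2 * deriv h w / (of_real r)\<^sup>2) \<ge> - C * a * (1 / r - 1)"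
    unfolding B1_def by (subst (asm) mult_le_cancel_left_pos) auto
  \<comment> \<open>the weight s in the inequality of means balances the two terms bounding the integral of |Im q|\<close>
  define s where "s = sqrt (1 / r - 1)"
  have s: "s > 0" "s * s = 1 / r - 1" using r by (auto simp: s_def)
  have "((\<lambda>t. Im (B2 (z t) * of_real (P t))) has_integral Im (2 * pi * B2 w)) {0..2 * pi}"
    unfolding P_def z_def by (rule has_integral_Im[OF Poisson_circle[OF hol(2) w]])
  hence Im_int: "((\<lambda>t. Im (q t) * P t) has_integral 2 * pi * Im (B2 w)) {0..2 * pi}"
    by (simp add: B)
  have dom_int: "((\<lambda>t. C * (d t / (2 * s) + s * norm (q t))) has_integral
      C * ((I - 2 * pi * a) / (2 * s) + s * I)) {0..2 * pi}"
    by (intro has_integral_mult_right has_integral_add has_integral_divide d norm_q)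
  have dom: "norm (Im (q t) * P t) \<le> C * (d t / (2 * s) + s * norm (q t))" for t
  proof -
    let ?e = "norm (q t) + Re (q t)"
    have "?e \<le> 2 * norm (q t)" "0 \<le> ?e"
      using complex_Re_le_cmod[of "q t"] abs_Re_le_cmod[of "q t"] by linarith+
    have "d t * ?e = (norm (q t))\<^sup>2 - (Re (q t))\<^sup>2"
      by (simp add: d_def power2_eq_square algebra_simps)
    hence "(Im (q t))\<^sup>2 = d t * ?e" using cmod_power2[of "q t"] by simp
    also have "\<dots> = (d t / s) * (s * ?e)" using s by simp
    also have "\<dots> \<le> ((d t / s + s * ?e) / 2)\<^sup>2"
    proof -
      have "((x + y) / 2)\<^sup>2 - x * y = ((x - y) / 2)\<^sup>2" for x y :: real
        by (simp add: power2_eq_square field_simps)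
      thus ?thesis by (metis diff_ge_0_iff_ge zero_le_power2)
    qed
    finally have "\<bar>Im (q t)\<bar>\<^sup>2 \<le> ((d t / s + s * ?e) / 2)\<^sup>2" by simp
    hence "\<bar>Im (q t)\<bar> \<le> (d t / s + s * ?e) / 2"
      by (rule power2_le_imp_le) (use s d_nonneg \<open>0 \<le> ?e\<close> in simp)
    also have "\<dots> \<le> d t / (2 * s) + s * norm (q t)"
      using s \<open>?e \<le> 2 * norm (q t)\<close> by (simp add: field_simps)
    finally have "\<bar>Im (q t)\<bar> \<le> d t / (2 * s) + s * norm (q t)" .
    from mult_mono[OF this P(2)] P(1) show ?thesis
      using s d_nonneg by (simp add: abs_mult mult.commute)
  qed
  have "\<bar>2 * pi * Im (B2 w)\<bar> \<le> C * ((I - 2 * pi * a) / (2 * s) + s * I)"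
    using integral_norm_bound_integral[OF has_integral_integrable[OF Im_int]
        has_integral_integrable[OF dom_int] dom]
    unfolding integral_unique[OF Im_int] integral_unique[OF dom_int] real_norm_def .
  also have "\<dots> \<le> C * (2 * pi * a * (s * s) / (2 * s) + s * (2 * pi * a / r))"
    using d_le I_le s \<open>C \<ge> 0\<close>
    by (intro mult_left_mono add_mono divide_right_mono) auto
  also have "\<dots> = 2 * pi * (C * a * s * (1 / 2 + 1 / r))"
    using s by (simp add: field_simps)
  finally show "\<bar>Im (deriv g w + w\<^sup>2 * deriv h w / (of_real r)\<^sup>2)\<bar> \<le>
      C * a * sqrt (1 / r - 1) * (1 / 2 + 1 / r)"
    unfolding B2_def s_def[symmetric] by (simp add: abs_mult)
qed

lemma extremal_derivs:
  assumes a: "deriv g 0 = of_real a" "M \<le> 2 * pi * a" and w: "w \<in> unit_disk"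
  shows "deriv g w + w\<^sup>2 * deriv h w = of_real a" and "Re (deriv g w - w\<^sup>2 * deriv h w) \<ge> 0"
proof -
  have lim: "Im (deriv g w + w\<^sup>2 * deriv h w) = 0 \<and> Re (deriv g w - w\<^sup>2 * deriv h w) \<ge> 0"
    if w: "w \<in> unit_disk" for w
  proof
    define C where "C = (\<lambda>r. (r + norm w) / (r - norm w))"
    have nw: "norm w < 1" using w by simp
    have ev: "eventually (\<lambda>r. norm w < r \<and> 0 < r \<and> r < 1) (at_left 1)"
      unfolding eventually_at_left[OF zero_less_one] using nw
      by (intro bexI[of _ "norm w"] exI[of _ "norm w"]) (auto intro: le_less_trans[OF norm_ge_zero])
    have C: "(C \<longlongrightarrow> C 1) (at_left 1)"
      unfolding C_def using nw by (intro tendsto_intros) auto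
    have "((\<lambda>r. - C r * a * (1 / r - 1)) \<longlongrightarrow> - C 1 * a * (1 / 1 - 1)) (at_left 1)"
      by (intro tendsto_intros C) auto
    moreover have "((\<lambda>r. Re (deriv g w - w\<^sup>2 * deriv h w / (of_real r)\<^sup>2)) \<longlongrightarrow>
        Re (deriv g w - w\<^sup>2 * deriv h w / (of_real 1)\<^sup>2)) (at_left 1)"
      by (intro tendsto_intros) auto
    moreover have "eventually (\<lambda>r. - C r * a * (1 / r - 1) \<le>
        Re (deriv g w - w\<^sup>2 * deriv h w / (of_real r)\<^sup>2)) (at_left 1)"
      using ev by eventually_elim (use extremal_defect(1)[OF a] in \<open>simp add: C_def\<close>)
    ultimately show "Re (deriv g w - w\<^sup>2 * deriv h w) \<ge> 0"
      using tendsto_le[OF trivial_limit_at_left_real] by fastforce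
    have "((\<lambda>r. C r * a * sqrt (1 / r - 1) * (1 / 2 + 1 / r)) \<longlongrightarrow>
        C 1 * a * sqrt (1 / 1 - 1) * (1 / 2 + 1 / 1)) (at_left 1)"
      by (intro tendsto_intros C) auto
    moreover have "((\<lambda>r. \<bar>Im (deriv g w + w\<^sup>2 * deriv h w / (of_real r)\<^sup>2)\<bar>) \<longlongrightarrow>
        \<bar>Im (deriv g w + w\<^sup>2 * deriv h w / (of_real 1)\<^sup>2)\<bar>) (at_left 1)"
      by (intro tendsto_intros) auto
    moreover have "eventually (\<lambda>r. \<bar>Im (deriv g w + w\<^sup>2 * deriv h w / (of_real r)\<^sup>2)\<bar> \<le>
        C r * a * sqrt (1 / r - 1) * (1 / 2 + 1 / r)) (at_left 1)"
      using ev by eventually_elim (use extremal_defect(2)[OF a] in \<open>simp add: C_def\<close>)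
    ultimately have "\<bar>Im (deriv g w + w\<^sup>2 * deriv h w / (of_real 1)\<^sup>2)\<bar> \<le>
        C 1 * a * sqrt (1 / 1 - 1) * (1 / 2 + 1 / 1)"
      using tendsto_le[OF trivial_limit_at_left_real] by blast
    thus "Im (deriv g w + w\<^sup>2 * deriv h w) = 0" by simp
  qed
  have "(\<lambda>w. deriv g w + w\<^sup>2 * deriv h w) holomorphic_on unit_disk"
    by (intro holomorphic_intros derivs_holomorphic)
  from Im_zero_imp_constant[OF this _ w] lim
  show "deriv g w + w\<^sup>2 * deriv h w = of_real a" by (simp add: a(1))
  show "Re (deriv g w - w\<^sup>2 * deriv h w) \<ge> 0" using lim w by blast
qed

end

section \<open>Length of extremal curves\<close>

context harmonic_disk_map
begin

text \<open>
  Cauchy's estimate cannot be applied to \<open>h\<close>, which need not extend continuously to the boundary. But on a circle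
  around \<open>w\<close> the negative frequencies of \<open>f\<close> come from \<open>h\<close> alone, so \<open>h' w\<close> is bounded by the oscillation of
  \<open>f\<close> on the disk of radius \<open>1 - norm w\<close> around \<open>w\<close>, divided by that radius, up to a constant. This oscillation tends to 0 by uniform
  continuity.
\<close>
lemma little_Bloch_antiholomorphic_part:
  assumes "\<epsilon> > 0"
  obtains \<delta> where "\<delta> > 0" "\<delta> < 1"
    "\<And>w. 1 - \<delta> < norm w \<Longrightarrow> norm w < 1 \<Longrightarrow> (1 - norm w) * norm (deriv h w) \<le> \<epsilon>"
proof -
  obtain \<delta> where \<delta>: "\<delta> > 0"
      "\<And>x y. x \<in> cball 0 1 \<Longrightarrow> y \<in> cball 0 1 \<Longrightarrow> dist x y < \<delta> \<Longrightarrow> dist (f x) (f y) < \<epsilon> / 2"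
    using compact_uniformly_continuous[OF f_cont compact_cball] half_gt_zero[OF assms]
    unfolding uniformly_continuous_on_def by metis
  show ?thesis
  proof (rule that[of "min \<delta> (1 / 2)"])
    fix w :: complex assume w: "1 - min \<delta> (1 / 2) < norm w" "norm w < 1"
    define d where "d = 1 - norm w"
    have d: "0 < d" "d < \<delta>" using w by (auto simp: d_def)
    define p where "p = (\<lambda>\<zeta>. w + of_real d * \<zeta>)"
    have p: "p \<zeta> \<in> unit_disk" if "norm \<zeta> < 1" for \<zeta>
    proof -
      have "norm (p \<zeta>) \<le> norm w + d * norm \<zeta>"
        unfolding p_def using d norm_triangle_ineq[of w "of_real d * \<zeta>"] by (simp add: norm_mult)
      also have "d * norm \<zeta> < d * 1" using d that by (intro mult_strict_left_mono) auto
      finally show ?thesis by (simp add: d_def)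
    qed
    have hol: "(\<lambda>\<zeta>. F (p \<zeta>)) holomorphic_on cball 0 (1 / 2)" if "F holomorphic_on unit_disk" for F
    proof -
      have "F \<circ> p holomorphic_on cball 0 (1 / 2)"
        by (rule holomorphic_on_compose_gen[OF _ that]) (use p in \<open>auto simp: p_def intro!: holomorphic_intros\<close>)
      thus ?thesis by (simp add: o_def)
    qed
    \<comment> \<open>a circle of half the distance to the boundary, so that the closed disk stays inside\<close>
    let ?p = "\<lambda>t. p (of_real (1 / 2) * cis t)"
    have "((\<lambda>\<zeta>. h (p \<zeta>)) has_field_derivative deriv h w * of_real d) (at 0)"
    proof (rule DERIV_chain2[where f = h and g = p])
      show "(h has_field_derivative deriv h w) (at (p 0))"
        using holomorphic_derivI[OF h_hol, of w] w by (simp add: p_def)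
      show "(p has_field_derivative of_real d) (at 0)"
        unfolding p_def by (auto intro!: derivative_eq_intros)
    qed
    hence "(deriv ^^ 1) (\<lambda>\<zeta>. h (p \<zeta>)) 0 = deriv h w * of_real d" by (simp add: DERIV_imp_deriv)
    hence h_int: "((\<lambda>t. h (?p t) * cis (- t)) has_integral pi * (deriv h w * of_real d)) {0..2 * pi}"
      using Fourier_coefficient_circle[OF hol[OF h_hol], of 1] by (simp add: power2_eq_square)
    have "((\<lambda>t. (g (?p t)) * cis t) has_integral 0) {0..2 * pi}"
      using negative_Fourier_coefficient_circle[OF hol[OF g_hol], of 1] by simp
    hence "((\<lambda>t. cnj (g (?p t) * cis t)) has_integral cnj 0) {0..2 * pi}"
      by (rule has_integral_linear[OF _ bounded_linear_cnj, unfolded o_def])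
    hence g_int: "((\<lambda>t. cnj (g (?p t)) * cis (- t)) has_integral 0) {0..2 * pi}"
      by (simp add: cis_cnj)
    have c_int: "((\<lambda>t. cnj (f w) * cis (- t)) has_integral 0) {0..2 * pi}"
      using Fourier_coefficient_circle[of "\<lambda>_. cnj (f w)" 1 1] by (simp add: holomorphic_intros)
    have "((\<lambda>t. (cnj (g (?p t)) * cis (- t) + h (?p t) * cis (- t)) - cnj (f w) * cis (- t)) has_integral
        (0 + pi * (deriv h w * of_real d)) - 0) {0..2 * pi}"
      by (intro has_integral_diff has_integral_add g_int h_int c_int)
    moreover have "f (?p t) = g (?p t) + cnj (h (?p t))" for t
      by (intro f_eq p) (simp add: norm_mult)
    ultimately have int: "((\<lambda>t. cnj (f (?p t) - f w) * cis (- t)) has_integral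
        pi * (deriv h w * of_real d)) {0..2 * pi}"
      by (simp add: algebra_simps)
    have "norm (cnj (f (?p t) - f w) * cis (- t)) \<le> \<epsilon> / 2" for t
    proof -
      have "dist (?p t) w < \<delta>" using d by (simp add: p_def dist_norm norm_mult)
      moreover have "?p t \<in> cball 0 1" using p[of "of_real (1 / 2) * cis t"] by (simp add: norm_mult)
      ultimately have "dist (f (?p t)) (f w) < \<epsilon> / 2" using w by (intro \<delta>(2)) auto
      thus ?thesis by (simp add: norm_mult dist_norm flip: complex_cnj_diff)
    qed
    hence "norm (integral {0..2 * pi} (\<lambda>t. cnj (f (?p t) - f w) * cis (- t))) \<le>
        integral {0..2 * pi} (\<lambda>t. \<epsilon> / 2)"
      using int by (intro integral_norm_bound_integral) (auto dest: has_integral_integrable)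
    hence "pi * (norm (deriv h w) * d) \<le> pi * \<epsilon>"
      using d unfolding integral_unique[OF int] by (simp add: norm_mult)
    thus "(1 - norm w) * norm (deriv h w) \<le> \<epsilon>" by (simp add: d_def mult.commute)
  qed (use \<delta>(1) in auto)
qed

text \<open>
  The bound on the speed has the explicit antiderivative \<open>\<phi>\<close>: if \<open>D' z = z * h' z\<close>, then
  \<open>t \<mapsto> Im (D (r * cis t))\<close> has derivative \<open>Re (z\<^sup>2 * h' z)\<close>. Since \<open>D\<close> is single-valued, \<open>\<phi>\<close> increases
  over one period by \<open>2 * pi * a * r\<close> and the error only. The polygon is compared with its image on the circle of radius
  \<open>r\<close>, and \<open>r\<close> tends to 1.
\<close>
lemma perimeter_le_if_extremal_derivs:
  fixes a :: real
  assumes sum: "\<And>w. w \<in> unit_disk \<Longrightarrow> deriv g w + w\<^sup>2 * deriv h w = of_real a"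
    and Re: "\<And>w. w \<in> unit_disk \<Longrightarrow> 2 * Re (w\<^sup>2 * deriv h w) \<le> a"
    and x: "x \<in> polygonal_sums (\<lambda>t. f (cis t)) 0 (2 * pi)"
  shows "x \<le> 2 * pi * a"
proof -
  obtain n s where s: "x = (\<Sum>i<n. dist (f (cis (s i))) (f (cis (s (Suc i)))))"
      "s 0 = 0" "s n = 2 * pi" "\<And>i. i < n \<Longrightarrow> s i \<le> s (Suc i)"
    using x by (elim polygonal_sumsE) blast
  define X where "X = (\<lambda>r. \<Sum>i<n. dist (f (of_real r * cis (s i))) (f (of_real r * cis (s (Suc i)))))"
  have "continuous_on {0..1} X"
    unfolding X_def by (intro continuous_intros continuous_on_compose2[OF f_cont]) (auto simp: norm_mult)
  hence X_lim: "(X \<longlongrightarrow> X 1) (at_left 1)"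
    by (simp add: continuous_on_Icc_at_leftD)
  show ?thesis
  proof (rule field_le_epsilon)
    fix e :: real assume "e > 0"
    \<comment> \<open>the error 2 * eps in the speed contributes 4 * pi * eps over a period\<close>
    define \<epsilon> where "\<epsilon> = e / (4 * pi)"
    have "\<epsilon> > 0" using \<open>e > 0\<close> by (simp add: \<epsilon>_def)
    then obtain \<delta> where \<delta>: "\<delta> > 0" "\<delta> < 1"
        "\<And>w. 1 - \<delta> < norm w \<Longrightarrow> norm w < 1 \<Longrightarrow> (1 - norm w) * norm (deriv h w) \<le> \<epsilon>"
      using little_Bloch_antiholomorphic_part by metis
    have "X r \<le> 2 * pi * a * r + e" if r: "1 - \<delta> < r" "r < 1" for r
    proof -
      have "0 < r" using r \<delta> by simp
      define z where "z = (\<lambda>t. of_real r * cis t)"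
      have z: "z t \<in> unit_disk" "norm (z t) = r" for t
        using r \<open>0 < r\<close> by (auto simp: z_def norm_mult)
      define D where "D = disk_primitive (\<lambda>z. z * deriv h z)"
      have D: "(D has_field_derivative (y * deriv h y)) (at y)" if "y \<in> unit_disk" for y
        unfolding D_def using that
        by (intro disk_primitive(3) holomorphic_intros derivs_holomorphic)
      define \<phi> where "\<phi> = (\<lambda>t. r * (a * t - 2 * Im (D (z t))) + 2 * \<epsilon> * t)"
      define \<phi>' where "\<phi>' = (\<lambda>t. r * (a - 2 * Re ((z t)\<^sup>2 * deriv h (z t))) + 2 * \<epsilon>)"
      have \<phi>: "(\<phi> has_vector_derivative \<phi>' t) (at t)" for t
      proof -
        have "(z has_vector_derivative \<i> * z t) (at t)"
          unfolding z_def
          by (auto intro!: derivative_eq_intros simp: has_vector_derivative_def scaleR_conv_of_real)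
        from field_vector_diff_chain_at[OF this D[OF z(1)]]
        have D': "((\<lambda>t. D (z t)) has_vector_derivative \<i> * ((z t)\<^sup>2 * deriv h (z t))) (at t)"
          by (simp add: o_def power2_eq_square mult_ac)
        define E where "E = (\<lambda>t. Im (D (z t)))"
        have "(E has_vector_derivative Im (\<i> * ((z t)\<^sup>2 * deriv h (z t)))) (at t)"
          unfolding E_def by (rule bounded_linear.has_vector_derivative[OF bounded_linear_Im D'])
        hence "(E has_real_derivative Re ((z t)\<^sup>2 * deriv h (z t))) (at t)"
          by (simp add: has_real_derivative_iff_has_vector_derivative)
        hence "((\<lambda>t. r * (a * t - 2 * E t) + 2 * \<epsilon> * t) has_real_derivative \<phi>' t) (at t)"
          unfolding \<phi>'_def by (auto intro!: derivative_eq_intros)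
        hence "(\<phi> has_real_derivative \<phi>' t) (at t)" by (simp add: \<phi>_def E_def)
        thus ?thesis by (simp add: has_real_derivative_iff_has_vector_derivative)
      qed
      have speed: "norm (\<i> * (z t * deriv g (z t) - cnj (z t * deriv h (z t)))) \<le> \<phi>' t" for t
      proof -
        define H where "H = (z t)\<^sup>2 * deriv h (z t)"
        have g': "deriv g (z t) = of_real a - H" using sum[OF z(1)] by (simp add: H_def algebra_simps)
        have "z t * cnj (z t) = of_real (r\<^sup>2)"
          by (simp add: z_def cis_cnj cis_mult power2_eq_square)
        hence zz: "cnj (z t) = of_real (r\<^sup>2) / z t" using z(2)[of t] \<open>0 < r\<close> by (auto simp: field_simps)
        define Y where "Y = cnj (z t * deriv h (z t))"
        have "Y * of_real (r\<^sup>2) = z t * cnj H"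
          using z(2)[of t] \<open>0 < r\<close> by (auto simp: Y_def H_def zz power2_eq_square)
        moreover have "of_real (a - 2 * Re H) = of_real a - H - cnj H"
          by (simp add: complex_eq_iff)
        moreover have "of_real (1 - r\<^sup>2) = 1 - of_real (r\<^sup>2)" for r :: real by simp
        ultimately have "z t * deriv g (z t) - Y = z t * of_real (a - 2 * Re H) - of_real (1 - r\<^sup>2) * Y"
          unfolding g' by (simp only: right_diff_distrib left_diff_distrib mult_ac mult_1)
            (simp add: algebra_simps del: of_real_power)
        hence "z t * deriv g (z t) - cnj (z t * deriv h (z t)) =
            z t * of_real (a - 2 * Re H) - of_real (1 - r\<^sup>2) * cnj (z t * deriv h (z t))"
          unfolding Y_def .
        also have "norm \<dots> \<le> r * \<bar>a - 2 * Re H\<bar> + \<bar>1 - r\<^sup>2\<bar> * (r * norm (deriv h (z t)))"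
          by (rule order_trans[OF norm_triangle_ineq4]) (simp add: norm_mult z(2) flip: of_real_diff of_real_mult of_real_power)
        also have "\<bar>a - 2 * Re H\<bar> = a - 2 * Re H" using Re[OF z(1), of t] by (simp add: H_def)
        also have "\<bar>1 - r\<^sup>2\<bar> * (r * norm (deriv h (z t))) \<le> 2 * \<epsilon>"
        proof -
          have "\<bar>1 - r\<^sup>2\<bar> * r = (1 - r) * ((1 + r) * r)"
          proof -
            have "1 - r\<^sup>2 = (1 - r) * (1 + r)" by (simp add: power2_eq_square algebra_simps)
            thus ?thesis using r \<open>0 < r\<close> by (simp add: abs_mult)
          qed
          also have "(1 + r) * r \<le> 2 * 1" using r \<open>0 < r\<close> by (intro mult_mono) auto
          finally have "\<bar>1 - r\<^sup>2\<bar> * r \<le> (1 - r) * 2" using r by (simp add: mult_left_mono)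
          hence "\<bar>1 - r\<^sup>2\<bar> * r * norm (deriv h (z t)) \<le> (1 - r) * 2 * norm (deriv h (z t))"
            by (rule mult_right_mono) simp
          moreover have "(1 - r) * norm (deriv h (z t)) \<le> \<epsilon>" using \<delta>(3)[of "z t"] r by (simp add: z(2))
          ultimately show ?thesis by (simp add: algebra_simps)
        qed
        finally show ?thesis by (simp add: norm_mult \<phi>'_def H_def)
      qed
      have "dist (f (z (s i))) (f (z (s (Suc i)))) \<le> \<phi> (s (Suc i)) - \<phi> (s i)" if "i < n" for i
      proof (cases "s i = s (Suc i)")
        case False
        hence "s i < s (Suc i)" using s(4)[OF that] by simp
        moreover have f_vel: "((\<lambda>t. f (z t)) has_vector_derivative
            \<i> * (z t * deriv g (z t) - cnj (z t * deriv h (z t)))) (at t within S)" for t S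
          unfolding z_def using r \<open>0 < r\<close> by (intro circle_velocity) auto
        ultimately have "norm (f (z (s (Suc i))) - f (z (s i))) \<le> \<phi> (s (Suc i)) - \<phi> (s i)"
          by (intro differentiable_bound_general[OF _ _ _ _ \<phi> speed])
            (auto intro!: continuous_at_imp_continuous_on has_vector_derivative_continuous[OF f_vel]
              has_vector_derivative_continuous[OF \<phi>])
        thus ?thesis by (simp add: dist_norm norm_minus_commute)
      qed simp
      hence "X r \<le> (\<Sum>i<n. \<phi> (s (Suc i)) - \<phi> (s i))"
        unfolding X_def z_def by (intro sum_mono) auto
      also have "\<dots> = \<phi> (2 * pi) - \<phi> 0" 
        using sum_lessThan_telescope[of "\<lambda>i. \<phi> (s i)" n] s(2,3) by simp
      also have "\<dots> = 2 * pi * a * r + e"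
      proof -
        have "z (2 * pi) = z 0" by (simp add: z_def)
        thus ?thesis by (simp add: \<phi>_def \<epsilon>_def algebra_simps)
      qed
      finally show ?thesis .
    qed
    hence "eventually (\<lambda>r. X r \<le> 2 * pi * a * r + e) (at_left 1)"
      unfolding eventually_at_left[OF zero_less_one] using \<delta> by (intro bexI[of _ "1 - \<delta>"] exI[of _ "1 - \<delta>"]) auto
    moreover have "((\<lambda>r. 2 * pi * a * r + e) \<longlongrightarrow> 2 * pi * a * 1 + e) (at_left 1)"
      by (intro tendsto_intros)
    ultimately have "X 1 \<le> 2 * pi * a * 1 + e"
      using X_lim tendsto_le[OF trivial_limit_at_left_real] by blast
    thus "x \<le> 2 * pi * a + e" by (simp add: X_def s(1))
  qed
qed

end

section \<open>Automorphisms of the disk\<close>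

lemma disk_aut_denominator_nonzero:
  assumes "norm z < 1" "norm w \<le> 1"
  shows "1 - cnj z * w \<noteq> 0"
proof
  assume "1 - cnj z * w = 0"
  hence "norm (cnj z * w) = 1" by simp
  moreover have "norm z * norm w \<le> norm z * 1" using assms by (intro mult_left_mono) auto
  ultimately show False using assms by (simp add: norm_mult)
qed

lemma disk_aut_in_disk:
  assumes "norm z < 1" "norm w < 1"
  shows "norm (disk_aut z w) < 1"
  using Moebius_function_norm_lt_1[OF assms, of 0]
  by (simp add: disk_aut_def Moebius_function_simple norm_divide norm_minus_commute)

lemma disk_aut_involution:
  assumes "norm z < 1" "norm w < 1"
  shows "disk_aut z (disk_aut z w) = w"
proof -
  define u where "u = 1 - cnj z * w"
  have u: "u \<noteq> 0" using disk_aut_denominator_nonzero[of z w] assms by (simp add: u_def)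
  have zz: "1 - cnj z * z \<noteq> 0" using disk_aut_denominator_nonzero[of z z] assms by simp
  have "z - (z - w) / u = w * (1 - cnj z * z) / u" "1 - cnj z * ((z - w) / u) = (1 - cnj z * z) / u"
    using u by (simp_all add: field_simps) (simp_all add: u_def algebra_simps)
  thus ?thesis unfolding disk_aut_def u_def[symmetric] using u zz by simp
qed

lemma disk_aut_0: "disk_aut z 0 = z"
  by (simp add: disk_aut_def)

lemma disk_aut_has_field_derivative_0:
  "(disk_aut z has_field_derivative - (1 - of_real ((norm z)\<^sup>2))) (at 0)"
proof -
  have "((\<lambda>w. (z - w) / (1 - cnj z * w)) has_field_derivative - (1 - z * cnj z)) (at 0)"
    by (auto intro!: derivative_eq_intros)
  thus ?thesis unfolding disk_aut_def[abs_def] complex_norm_square .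
qed

lemma disk_aut_holomorphic:
  assumes "norm z < 1"
  shows "disk_aut z holomorphic_on cball 0 1"
  unfolding disk_aut_def[abs_def] using disk_aut_denominator_nonzero[OF assms]
  by (auto intro!: holomorphic_intros)

text \<open>
  A lift of the boundary action to the real line: with \<open>u = 1 - cnj z * cis t\<close> the automorphism
  sends \<open>cis t\<close> to \<open>- cis t * cnj u / u\<close>. For \<open>norm z < 1\<close>, \<open>u\<close> stays in the right half-plane, so its argument is smooth and
  periodic in \<open>t\<close>, and the lift advances by exactly \<open>2 * pi\<close> per period.
\<close>
definition disk_aut_angle :: "complex \<Rightarrow> real \<Rightarrow> real" where
  "disk_aut_angle z t = t + pi - 2 * Arg (1 - cnj z * cis t)"

lemma disk_aut_cis:
  assumes "norm z < 1"
  shows "disk_aut z (cis t) = cis (disk_aut_angle z t)"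
proof -
  define u where "u = 1 - cnj z * cis t"
  have u: "u \<noteq> 0" using disk_aut_denominator_nonzero[OF assms, of "cis t"] by (simp add: u_def)
  have "cis (disk_aut_angle z t) = - cis t / (cis (Arg u))\<^sup>2"
    by (simp add: disk_aut_angle_def u_def[symmetric] cis_divide[symmetric] cis_mult[symmetric]
        Complex.DeMoivre)
  also have "(cis (Arg u))\<^sup>2 = u\<^sup>2 / (u * cnj u)"
    using u by (simp add: cis_Arg sgn_eq power_divide complex_norm_square del: of_real_power flip: of_real_power)
  also have "\<dots> = u / cnj u" using u by (simp add: power2_eq_square)
  also have "- cis t / (u / cnj u) = (z - cis t) / u"
  proof -
    have "- cis t * cnj u = z - cis t"
      by (simp add: u_def cis_cnj algebra_simps cis_mult)
    thus ?thesis by simp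
  qed
  finally show ?thesis by (simp add: disk_aut_def u_def)
qed

text \<open>
  With \<open>v = cnj z * cis t\<close> the derivative of the lift is \<open>1 + 2 * Re (v / (1 - v)) = Re ((1 + v) / (1 - v))\<close>, which is
  positive for \<open>norm v < 1\<close>.
\<close>
lemma disk_aut_angle_mono:
  assumes "norm z < 1"
  shows "mono (disk_aut_angle z)"
proof -
  have "\<exists>y. (disk_aut_angle z has_real_derivative y) (at t) \<and> 0 \<le> y" for t
  proof -
    define v where "v = cnj z * cis t"
    have v: "norm v < 1" using assms by (simp add: v_def norm_mult)
    have "Re v < 1" using complex_Re_le_cmod[of v] v by linarith
    hence Re: "0 < Re (1 - v)" by simp
    hence nz: "1 - v \<noteq> 0" "1 - v \<notin> \<real>\<^sub>\<le>\<^sub>0" by (auto simp: complex_nonpos_Reals_iff)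
    have "((\<lambda>s. 1 - cnj z * cis s) has_vector_derivative - (\<i> * v)) (at t)"
      by (auto intro!: derivative_eq_intros simp: has_vector_derivative_def scaleR_conv_of_real v_def)
    from field_vector_diff_chain_at[OF this, of Ln "1 / (1 - v)"] nz
    have "((\<lambda>s. Ln (1 - cnj z * cis s)) has_vector_derivative - (\<i> * v / (1 - v))) (at t)"
      using has_field_derivative_Ln[of "1 - v"] by (simp add: o_def v_def inverse_eq_divide)
    from bounded_linear.has_vector_derivative[OF bounded_linear_Im this]
    have "((\<lambda>s. Im (Ln (1 - cnj z * cis s))) has_real_derivative - Re (v / (1 - v))) (at t)"
      unfolding times_divide_eq_right[symmetric]
      by (simp only: has_real_derivative_iff_has_vector_derivative uminus_complex.simps
          times_complex.simps imaginary_unit.simps) simp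
    moreover have "(\<lambda>s. Im (Ln (1 - cnj z * cis s))) = (\<lambda>s. Arg (1 - cnj z * cis s))"
      using disk_aut_denominator_nonzero[OF assms] by (simp add: Arg_eq_Im_Ln)
    ultimately have "((\<lambda>s. Arg (1 - cnj z * cis s)) has_real_derivative - Re (v / (1 - v))) (at t)"
      by simp
    hence "(disk_aut_angle z has_real_derivative 1 + 2 * Re (v / (1 - v))) (at t)"
      unfolding disk_aut_angle_def[abs_def] by (auto intro!: derivative_eq_intros)
    moreover have "0 \<le> 1 + 2 * Re (v / (1 - v))"
    proof -
      have "v / (1 - v) = 1 / (1 - v) - 1" using nz by (simp add: field_simps)
      hence eq: "1 + 2 * Re (v / (1 - v)) = 2 * Re (1 - v) / (norm (1 - v))\<^sup>2 - 1"
        by (simp add: Re_divide cmod_power2)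
      have "(norm (1 - v))\<^sup>2 \<le> 2 * Re (1 - v)"
      proof -
        have "(norm v)\<^sup>2 \<le> 1" using v by (simp add: power_le_one)
        thus ?thesis unfolding cmod_power2 by (simp add: power2_eq_square algebra_simps)
      qed
      moreover have "0 < (norm (1 - v))\<^sup>2" using nz by simp
      ultimately have "1 \<le> 2 * Re (1 - v) / (norm (1 - v))\<^sup>2" by (simp only: le_divide_eq_1_pos)
      thus ?thesis using eq by linarith
    qed
    ultimately show ?thesis by blast
  qed
  thus ?thesis
    using DERIV_nonneg_imp_nondecreasing[of _ _ "disk_aut_angle z"] by (meson monoI)
qed

lemma polygonal_sums_disk_aut_le:
  assumes "norm z < 1"
    and "\<And>x. x \<in> polygonal_sums (\<lambda>t. F (cis t)) 0 (2 * pi) \<Longrightarrow> x \<le> M"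
    and "x \<in> polygonal_sums (\<lambda>t. F (disk_aut z (cis t))) 0 (2 * pi)"
  shows "x \<le> M"
proof (rule polygonal_sums_circle_base_point[where F = F and c = "disk_aut_angle z 0", OF assms(2)])
  have "disk_aut_angle z (2 * pi) = disk_aut_angle z 0 + 2 * pi" by (simp add: disk_aut_angle_def)
  thus "x \<in> polygonal_sums (\<lambda>t. F (cis t)) (disk_aut_angle z 0) (disk_aut_angle z 0 + 2 * pi)"
    using polygonal_sums_reparametrize[OF disk_aut_angle_mono[OF assms(1)], of "\<lambda>t. F (cis t)" 0 "2 * pi"]
      assms(3) by (auto simp: disk_aut_cis[OF assms(1)])
qed

section \<open>Symmetries of the extremal problem\<close>

abbreviation (input) perimeter :: "(complex \<Rightarrow> complex) \<Rightarrow> real" where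
  "perimeter f \<equiv> curve_length (\<lambda>t. f (cis t)) 0 (2 * pi)"

locale rectifiable_disk_map = harmonic_disk_map +
  assumes rectifiable: "rectifiable_curve (\<lambda>t. f (cis t)) 0 (2 * pi)"

sublocale rectifiable_disk_map \<subseteq> bounded_perimeter f g h "perimeter f"
  by unfold_locales (rule polygonal_sums_le_curve_length[OF rectifiable])

context rectifiable_disk_map
begin

lemma conjugate:
  shows "rectifiable_disk_map (\<lambda>z. cnj (f z)) h g" and "perimeter (\<lambda>z. cnj (f z)) \<le> perimeter f"
proof -
  have dist: "dist (cnj (f (cis s))) (cnj (f (cis t))) = 1 * dist (f (cis s)) (f (cis t))" for s t
    by (simp add: dist_norm flip: complex_cnj_diff)
  note dilation = curve_length_dilation_le[OF dist _ _ rectifiable]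
  show "rectifiable_disk_map (\<lambda>z. cnj (f z)) h g"
    using dilation(1) by unfold_locales (auto intro!: continuous_intros f_cont g_hol h_hol simp: f_eq)
  show "perimeter (\<lambda>z. cnj (f z)) \<le> perimeter f"
    using dilation(2) by simp
qed

lemma scale:
  shows "rectifiable_disk_map (\<lambda>z. c * f z) (\<lambda>z. c * g z) (\<lambda>z. cnj c * h z)"
    and "perimeter (\<lambda>z. c * f z) \<le> norm c * perimeter f"
proof -
  have dist: "dist (c * f (cis s)) (c * f (cis t)) = norm c * dist (f (cis s)) (f (cis t))" for s t
    by (simp add: dist_norm norm_mult flip: right_diff_distrib)
  note dilation = curve_length_dilation_le[OF dist _ _ rectifiable]
  show "rectifiable_disk_map (\<lambda>z. c * f z) (\<lambda>z. c * g z) (\<lambda>z. cnj c * h z)"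
    using dilation(1) by unfold_locales
      (auto intro!: continuous_intros holomorphic_intros f_cont g_hol h_hol simp: f_eq algebra_simps)
  show "perimeter (\<lambda>z. c * f z) \<le> norm c * perimeter f"
    using dilation(2) by simp
qed

lemma perimeter_scale: "perimeter (\<lambda>z. c * f z) = norm c * perimeter f"
proof (cases "c = 0")
  case True
  interpret s: rectifiable_disk_map "\<lambda>z. c * f z" "\<lambda>z. c * g z" "\<lambda>z. cnj c * h z" by (rule scale)
  show ?thesis using scale(2)[of c] s.perimeter_nonneg True by simp
next
  case False
  interpret s: rectifiable_disk_map "\<lambda>z. c * f z" "\<lambda>z. c * g z" "\<lambda>z. cnj c * h z" by (rule scale)
  have "perimeter f \<le> norm (1 / c) * perimeter (\<lambda>z. c * f z)"
    using s.scale(2)[of "1 / c"] False by simp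
  thus ?thesis using scale(2)[of c] False by (simp add: norm_divide field_simps)
qed

text \<open>
  Precomposition does not increase the perimeter, and the automorphism is an involution, so the perimeters agree.
\<close>
lemma precompose_disk_aut:
  assumes z: "norm z < 1"
  shows "rectifiable_disk_map (\<lambda>w. f (disk_aut z w)) (\<lambda>w. g (disk_aut z w)) (\<lambda>w. h (disk_aut z w))"
    and "perimeter (\<lambda>w. f (disk_aut z w)) = perimeter f"
proof -
  note sums_le = polygonal_sums_disk_aut_le[where F = f, OF z perimeter_le]
  have hol: "(\<lambda>w. F (disk_aut z w)) holomorphic_on unit_disk" if "F holomorphic_on unit_disk" for F
  proof -
    have "F \<circ> disk_aut z holomorphic_on unit_disk"
      by (rule holomorphic_on_compose_gen[OF holomorphic_on_subset[OF disk_aut_holomorphic[OF z]] that])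
        (use disk_aut_in_disk[OF z] in auto)
    thus ?thesis by (simp add: o_def)
  qed
  have closed: "norm (disk_aut z w) \<le> 1" if "norm w \<le> 1" for w
  proof (cases "norm w < 1")
    case True
    thus ?thesis using disk_aut_in_disk[OF z] by (simp add: less_imp_le)
  next
    case False
    hence "norm w = 1" using that by simp
    hence "w = cis (Arg w)" by (metis cis_Arg norm_zero sgn_eq zero_neq_one div_by_1 of_real_1)
    thus ?thesis using disk_aut_cis[OF z, of "Arg w"] by (metis norm_cis order_refl)
  qed
  show "rectifiable_disk_map (\<lambda>w. f (disk_aut z w)) (\<lambda>w. g (disk_aut z w)) (\<lambda>w. h (disk_aut z w))"
  proof
    show "continuous_on (cball 0 1) (\<lambda>w. f (disk_aut z w))"
      by (rule continuous_on_compose2[OF f_cont holomorphic_on_imp_continuous_on[OF disk_aut_holomorphic[OF z]]])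
        (use closed in auto)
    show "f (disk_aut z w) = g (disk_aut z w) + cnj (h (disk_aut z w))" if "w \<in> unit_disk" for w
      using that disk_aut_in_disk[OF z] by (intro f_eq) auto
    show "rectifiable_curve (\<lambda>t. f (disk_aut z (cis t))) 0 (2 * pi)"
      unfolding rectifiable_curve_def using sums_le by (rule bdd_aboveI)
  qed (intro hol g_hol h_hol)+
  \<comment> \<open>the involution identity passes from the open disk to its boundary by continuity\<close>
  have invol: "disk_aut z (disk_aut z (cis t)) = cis t" for t
  proof -
    have "continuous_on (cball 0 1) (\<lambda>w. disk_aut z (disk_aut z w) - w)"
      by (intro continuous_intros
          continuous_on_compose2[OF holomorphic_on_imp_continuous_on[OF disk_aut_holomorphic[OF z]]
            holomorphic_on_imp_continuous_on[OF disk_aut_holomorphic[OF z]]])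
        (use closed in auto)
    hence "continuous_on (closure unit_disk) (\<lambda>w. disk_aut z (disk_aut z w) - w)" by simp
    from continuous_constant_on_closure[OF this, of 0 "cis t"] disk_aut_involution[OF z]
    show ?thesis by simp
  qed
  have "x \<le> perimeter (\<lambda>w. f (disk_aut z w))"
    if "x \<in> polygonal_sums (\<lambda>t. f (cis t)) 0 (2 * pi)" for x
  proof (rule polygonal_sums_disk_aut_le[OF z, of "\<lambda>w. f (disk_aut z w)"])
    show "y \<le> perimeter (\<lambda>w. f (disk_aut z w))"
      if "y \<in> polygonal_sums (\<lambda>t. f (disk_aut z (cis t))) 0 (2 * pi)" for y
    proof (rule polygonal_sums_le_curve_length[OF _ that])
      show "rectifiable_curve (\<lambda>t. f (disk_aut z (cis t))) 0 (2 * pi)"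
        unfolding rectifiable_curve_def using sums_le by (rule bdd_aboveI)
    qed
  qed (use that in \<open>simp add: invol\<close>)
  hence "perimeter f \<le> perimeter (\<lambda>w. f (disk_aut z w))" by (intro curve_length_le) auto
  moreover have "perimeter (\<lambda>w. f (disk_aut z w)) \<le> perimeter f"
    by (intro curve_length_le sums_le) auto
  ultimately show "perimeter (\<lambda>w. f (disk_aut z w)) = perimeter f" by simp
qed

lemma norm_deriv_precompose_disk_aut:
  assumes z: "norm z < 1"
  shows "norm (deriv (\<lambda>w. g (disk_aut z w)) 0) = (1 - (norm z)\<^sup>2) * norm (deriv g z)"
proof -
  have "((\<lambda>w. g (disk_aut z w)) has_field_derivative deriv g z * - (1 - of_real ((norm z)\<^sup>2))) (at 0)"
    by (rule DERIV_chain2[where f = g and g = "disk_aut z"])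
      (use holomorphic_derivI[OF g_hol, of z] z disk_aut_has_field_derivative_0 in \<open>auto simp: disk_aut_0\<close>)
  hence "norm (deriv (\<lambda>w. g (disk_aut z w)) 0) = norm (deriv g z) * norm (1 - of_real ((norm z)\<^sup>2) :: complex)"
    by (simp only: DERIV_imp_deriv norm_mult norm_minus_cancel)
  also have "norm (1 - of_real ((norm z)\<^sup>2) :: complex) = \<bar>1 - (norm z)\<^sup>2\<bar>"
    by (metis norm_of_real of_real_1 of_real_diff)
  also have "\<dots> = 1 - (norm z)\<^sup>2" using z by (simp add: power_le_one)
  finally show ?thesis by simp
qed

section \<open>Equality at the origin\<close>

lemma deriv_0_le: "2 * pi * norm (deriv g 0) \<le> perimeter f"
  using coefficient_le[of 0] by simp

lemma deriv_0_eq_iff_pos: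
  assumes a: "a > 0" "deriv g 0 = of_real a"
  shows "2 * pi * norm (deriv g 0) = perimeter f \<longleftrightarrow>
    (\<forall>w\<in>unit_disk. deriv g w + w\<^sup>2 * deriv h w = of_real a \<and> 2 * Re (w\<^sup>2 * deriv h w) < a)"
proof (intro iffI ballI)
  fix w assume eq: "2 * pi * norm (deriv g 0) = perimeter f" and w: "w \<in> unit_disk"
  hence "perimeter f \<le> 2 * pi * a" using a by simp
  note extremal = extremal_derivs[OF a(2) this]
  have "Re (deriv g w - w\<^sup>2 * deriv h w) > 0"
  proof (rule Re_pos_if_Re_nonneg[OF _ extremal(2) _ w])
    show "(\<lambda>w. deriv g w - w\<^sup>2 * deriv h w) holomorphic_on unit_disk"
      by (intro holomorphic_intros derivs_holomorphic)
  qed (use a in auto)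
  moreover have "deriv g w = of_real a - w\<^sup>2 * deriv h w"
    using extremal(1)[OF w] by (simp add: algebra_simps)
  ultimately show "deriv g w + w\<^sup>2 * deriv h w = of_real a \<and> 2 * Re (w\<^sup>2 * deriv h w) < a"
    by (simp add: algebra_simps)
next
  assume "\<forall>w\<in>unit_disk. deriv g w + w\<^sup>2 * deriv h w = of_real a \<and> 2 * Re (w\<^sup>2 * deriv h w) < a"
  hence "perimeter f \<le> 2 * pi * a"
    by (intro curve_length_le perimeter_le_if_extremal_derivs) (auto intro: less_imp_le)
  thus "2 * pi * norm (deriv g 0) = perimeter f" using deriv_0_le a by simp
qed

lemma deriv_0_eq_iff_halfplane:
  assumes a: "a > 0" "deriv g 0 = of_real a"
  shows "2 * pi * norm (deriv g 0) = perimeter f \<longleftrightarrow>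
    (\<exists>H. H holomorphic_on unit_disk \<and> zero_of_order_ge 2 H \<and>
      (\<forall>z\<in>unit_disk. deriv g z = - H z + of_real a) \<and>
      (\<forall>z\<in>unit_disk - {0}. deriv h z = H z / z ^ 2) \<and>
      (\<lambda>z. 2 * H z) \<in> halfplane_family a)"
  unfolding deriv_0_eq_iff_pos[OF a]
proof
  assume extremal: "\<forall>w\<in>unit_disk. deriv g w + w\<^sup>2 * deriv h w = of_real a \<and> 2 * Re (w\<^sup>2 * deriv h w) < a"
  define H where "H = (\<lambda>w. w\<^sup>2 * deriv h w)"
  have H: "H holomorphic_on unit_disk" unfolding H_def by (intro holomorphic_intros derivs_holomorphic)
  moreover have "zero_of_order_ge 2 H"
    by (rule zero_of_order_ge_2I[OF derivs_holomorphic(2)]) (simp add: H_def)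
  moreover have "\<forall>z\<in>unit_disk. deriv g z = - H z + of_real a"
    using extremal by (simp add: H_def eq_diff_eq algebra_simps)
  moreover have "\<forall>z\<in>unit_disk - {0}. deriv h z = H z / z ^ 2"
    by (simp add: H_def)
  moreover have "(\<lambda>z. 2 * H z) \<in> halfplane_family a"
    unfolding halfplane_family_def using extremal H by (auto intro!: holomorphic_intros simp: H_def)
  ultimately show "\<exists>H. H holomorphic_on unit_disk \<and> zero_of_order_ge 2 H \<and>
      (\<forall>z\<in>unit_disk. deriv g z = - H z + of_real a) \<and>
      (\<forall>z\<in>unit_disk - {0}. deriv h z = H z / z ^ 2) \<and>
      (\<lambda>z. 2 * H z) \<in> halfplane_family a" by blast
next
  assume "\<exists>H. H holomorphic_on unit_disk \<and> zero_of_order_ge 2 H \<and>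
      (\<forall>z\<in>unit_disk. deriv g z = - H z + of_real a) \<and>
      (\<forall>z\<in>unit_disk - {0}. deriv h z = H z / z ^ 2) \<and>
      (\<lambda>z. 2 * H z) \<in> halfplane_family a"
  then obtain H where H: "\<And>z. z \<in> unit_disk \<Longrightarrow> deriv g z = - H z + of_real a"
      "\<And>z. z \<in> unit_disk - {0} \<Longrightarrow> deriv h z = H z / z ^ 2"
      "\<And>z. z \<in> unit_disk \<Longrightarrow> 2 * Re (H z) < a"
    by (auto simp: halfplane_family_def)
  have "w\<^sup>2 * deriv h w = H w" if "w \<in> unit_disk" for w
    using H(1)[of 0] H(2)[of w] that a(2) by (cases "w = 0") auto
  thus "\<forall>w\<in>unit_disk. deriv g w + w\<^sup>2 * deriv h w = of_real a \<and> 2 * Re (w\<^sup>2 * deriv h w) < a"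
    using H by simp
qed

text \<open>
  Dividing \<open>f\<close> by \<open>\<alpha>\<close> divides \<open>g\<close> by \<open>\<alpha>\<close> and \<open>h\<close> by \<open>cnj \<alpha>\<close>, and reduces to derivative 1 at the origin.
\<close>
lemma (in rectifiable_disk_map) deriv_0_eq_iff_normalized:
  assumes "deriv g 0 = \<alpha>" "\<alpha> \<noteq> 0"
  shows "2 * pi * norm (deriv g 0) = perimeter f \<longleftrightarrow>
    (\<forall>w\<in>unit_disk. deriv g w / \<alpha> + w\<^sup>2 * (deriv h w / cnj \<alpha>) = 1 \<and> Re (w\<^sup>2 * (deriv h w / cnj \<alpha>)) < 1 / 2)"
proof -
  interpret s: rectifiable_disk_map "\<lambda>z. 1 / \<alpha> * f z" "\<lambda>z. 1 / \<alpha> * g z" "\<lambda>z. cnj (1 / \<alpha>) * h z"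
    by (rule scale)
  have deriv: "deriv (\<lambda>z. 1 / \<alpha> * g z) w = deriv g w / \<alpha>"
    "deriv (\<lambda>z. cnj (1 / \<alpha>) * h z) w = deriv h w / cnj \<alpha>" if "w \<in> unit_disk" for w
    using DERIV_imp_deriv[OF DERIV_cmult[OF holomorphic_derivI[OF g_hol open_ball that], of "1 / \<alpha>"]]
      DERIV_imp_deriv[OF DERIV_cmult[OF holomorphic_derivI[OF h_hol open_ball that], of "cnj (1 / \<alpha>)"]]
    by simp_all
  have "2 * pi * norm (deriv g 0) = perimeter f \<longleftrightarrow>
      2 * pi * norm (deriv (\<lambda>z. 1 / \<alpha> * g z) 0) = perimeter (\<lambda>z. 1 / \<alpha> * f z)"
    unfolding perimeter_scale using assms deriv(1)[of 0] by (auto simp: norm_divide field_simps)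
  also have "\<dots> \<longleftrightarrow> (\<forall>w\<in>unit_disk.
      deriv (\<lambda>z. 1 / \<alpha> * g z) w + w\<^sup>2 * deriv (\<lambda>z. cnj (1 / \<alpha>) * h z) w = of_real 1 \<and>
      2 * Re (w\<^sup>2 * deriv (\<lambda>z. cnj (1 / \<alpha>) * h z) w) < 1)"
    using assms deriv(1)[of 0] by (intro s.deriv_0_eq_iff_pos) auto
  also have "\<dots> \<longleftrightarrow> (\<forall>w\<in>unit_disk. deriv g w / \<alpha> + w\<^sup>2 * (deriv h w / cnj \<alpha>) = 1 \<and>
      Re (w\<^sup>2 * (deriv h w / cnj \<alpha>)) < 1 / 2)"
  proof (intro ball_cong refl)
    fix w assume w: "w \<in> unit_disk"
    have half: "2 * x < 1 \<longleftrightarrow> x < 1 / 2" for x :: real by auto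
    show "deriv (\<lambda>z. 1 / \<alpha> * g z) w + w\<^sup>2 * deriv (\<lambda>z. cnj (1 / \<alpha>) * h z) w = of_real 1 \<and>
        2 * Re (w\<^sup>2 * deriv (\<lambda>z. cnj (1 / \<alpha>) * h z) w) < 1 \<longleftrightarrow>
        deriv g w / \<alpha> + w\<^sup>2 * (deriv h w / cnj \<alpha>) = 1 \<and> Re (w\<^sup>2 * (deriv h w / cnj \<alpha>)) < 1 / 2"
      unfolding deriv[OF w] half of_real_1 ..
  qed
  finally show ?thesis .
qed

text \<open>
  The degenerate case \<open>L = 0\<close>: all Taylor coefficients of \<open>g\<close> and \<open>h\<close> of positive index vanish by \<open>coefficient_le\<close>.
\<close>
lemma constant_if_perimeter_0:
  assumes "perimeter f = 0" "w \<in> unit_disk"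
  shows "f w = f 0"
proof -
  interpret c: rectifiable_disk_map "\<lambda>z. cnj (f z)" h g by (rule conjugate)
  have zero: "(deriv ^^ n) g 0 = 0" "(deriv ^^ n) h 0 = 0" if "0 < n" for n
  proof -
    obtain m where m: "n = Suc m" using \<open>0 < n\<close> by (cases n) auto
    show "(deriv ^^ n) g 0 = 0" using coefficient_le[of m] assms(1) pi_gt_zero unfolding m
      by (auto simp: mult_le_0_iff simp del: funpow.simps)
    show "(deriv ^^ n) h 0 = 0"
      using order_trans[OF c.coefficient_le[of m] conjugate(2)] assms(1) pi_gt_zero unfolding m
      by (auto simp: mult_le_0_iff simp del: funpow.simps)
  qed
  note const = holomorphic_fun_eq_const_on_connected[OF _ open_ball convex_connected[OF convex_ball] _ _ assms(2), of _ 0]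
  have "g w = g 0" "h w = h 0"
    using const[OF g_hol zero(1)] const[OF h_hol zero(2)] by auto
  thus ?thesis using assms(2) by (simp add: f_eq)
qed

end

section \<open>The extremal maps\<close>

text \<open>
  The half-plane \<open>Re p < 1 / 2\<close> consists of the points closer to 0 than to 1; \<open>p \<mapsto> p / (1 - p)\<close> maps it onto the
  unit disk.
\<close>
lemma Re_less_half_iff: "Re p < 1 / 2 \<longleftrightarrow> norm p < norm (1 - p)"
proof -
  have "(norm (1 - p))\<^sup>2 - (norm p)\<^sup>2 = 1 - 2 * Re p"
    unfolding cmod_power2 by (simp add: power2_eq_square algebra_simps)
  moreover have "norm p < norm (1 - p) \<longleftrightarrow> (norm p)\<^sup>2 < (norm (1 - p))\<^sup>2"
    by (metis linorder_not_less norm_ge_zero power2_le_imp_le power_mono)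
  ultimately show ?thesis by auto
qed

lemma one_minus_nonzero_if_Re_less_half: "Re p < 1 / 2 \<Longrightarrow> 1 - p \<noteq> 0"
  by auto

lemma admissible_denominator:
  assumes "admissible \<nu>" "w \<in> unit_disk"
  shows "norm (w\<^sup>2 * \<nu> w) < 1" "1 + w\<^sup>2 * \<nu> w \<noteq> 0"
proof -
  obtain \<omega> where "\<omega> ` unit_disk \<subseteq> unit_disk" "\<forall>z\<in>unit_disk - {0}. \<nu> z = \<omega> z / z ^ 2"
    using assms(1) by (auto simp: admissible_def)
  thus less: "norm (w\<^sup>2 * \<nu> w) < 1" using assms(2) by (cases "w = 0") (auto simp: image_subset_iff)
  show "1 + w\<^sup>2 * \<nu> w \<noteq> 0"
  proof
    assume "1 + w\<^sup>2 * \<nu> w = 0"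
    hence "w\<^sup>2 * \<nu> w = - 1" by (simp add: add_eq_0_iff)
    with less show False by simp
  qed
qed

lemma admissibleI:
  assumes "k holomorphic_on unit_disk" "\<And>w. w \<in> unit_disk \<Longrightarrow> Re (w\<^sup>2 * k w) < 1 / 2"
  shows "admissible (\<lambda>w. k w / (1 - w\<^sup>2 * k w))"
proof -
  define \<nu> where "\<nu> = (\<lambda>w. k w / (1 - w\<^sup>2 * k w))"
  have nz: "1 - w\<^sup>2 * k w \<noteq> 0" if "w \<in> unit_disk" for w
    by (rule one_minus_nonzero_if_Re_less_half[OF assms(2)[OF that]])
  have hol: "\<nu> holomorphic_on unit_disk"
    unfolding \<nu>_def using nz by (intro holomorphic_intros assms(1)) auto
  have "norm (w\<^sup>2 * \<nu> w) < 1" if "w \<in> unit_disk" for w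
  proof -
    have "norm (w\<^sup>2 * k w) / norm (1 - w\<^sup>2 * k w) < 1"
      using Re_less_half_iff[THEN iffD1, OF assms(2)[OF that]] nz[OF that] by simp
    thus ?thesis by (simp add: \<nu>_def norm_mult norm_divide)
  qed
  moreover have "zero_of_order_ge 2 (\<lambda>w. w\<^sup>2 * \<nu> w)" by (rule zero_of_order_ge_2I[OF hol]) simp
  moreover have "(\<lambda>w. w\<^sup>2 * \<nu> w) holomorphic_on unit_disk" by (intro holomorphic_intros hol)
  ultimately show ?thesis
    unfolding admissible_def \<nu>_def[symmetric] using hol
    by (intro conjI exI[of _ "\<lambda>w. w\<^sup>2 * \<nu> w"]) auto
qed

lemma extremal_map_parts:
  fixes \<nu> :: "complex \<Rightarrow> complex"
  assumes "admissible \<nu>"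
  defines "G \<equiv> disk_primitive (\<lambda>z. 1 / (1 + z ^ 2 * \<nu> z))"
    and "K \<equiv> disk_primitive (\<lambda>z. \<nu> z / (1 + z ^ 2 * \<nu> z))"
  shows "G holomorphic_on unit_disk" "K holomorphic_on unit_disk"
    and "w \<in> unit_disk \<Longrightarrow> (G has_field_derivative 1 / (1 + w\<^sup>2 * \<nu> w)) (at w)"
    and "w \<in> unit_disk \<Longrightarrow> (K has_field_derivative \<nu> w / (1 + w\<^sup>2 * \<nu> w)) (at w)"
    and "extremal_map \<nu> w = G w + cnj (K w)"
proof -
  have \<nu>: "\<nu> holomorphic_on unit_disk" using assms(1) by (simp add: admissible_def)
  have hol: "(\<lambda>z. 1 / (1 + z ^ 2 * \<nu> z)) holomorphic_on unit_disk"
    "(\<lambda>z. \<nu> z / (1 + z ^ 2 * \<nu> z)) holomorphic_on unit_disk"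
    using admissible_denominator(2)[OF assms(1)] by (intro holomorphic_intros \<nu>; blast)+
  show "G holomorphic_on unit_disk" "K holomorphic_on unit_disk"
    "w \<in> unit_disk \<Longrightarrow> (G has_field_derivative 1 / (1 + w\<^sup>2 * \<nu> w)) (at w)"
    "w \<in> unit_disk \<Longrightarrow> (K has_field_derivative \<nu> w / (1 + w\<^sup>2 * \<nu> w)) (at w)"
    unfolding G_def K_def using disk_primitive(1,3)[OF hol(1)] disk_primitive(1,3)[OF hol(2)] by auto
  show "extremal_map \<nu> w = G w + cnj (K w)" by (simp add: extremal_map_def G_def K_def)
qed

context rectifiable_disk_map
begin

text \<open>
  With \<open>k\<close> the normalised \<open>h'\<close>, the admissible function is \<open>\<nu> = k / (1 - z\<^sup>2 * k)\<close>; it satisfies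
  \<open>1 / (1 + z\<^sup>2 * \<nu>) = 1 - z\<^sup>2 * k\<close> and \<open>\<nu> / (1 + z\<^sup>2 * \<nu>) = k\<close>, the normalised derivatives of \<open>g\<close> and \<open>h\<close>. When
  \<open>g' 0 = 0\<close> the perimeter is 0 and \<open>f\<close> is constant, so \<open>c = 0\<close>.
\<close>
lemma extremal_map_if_deriv_0_eq:
  assumes eq: "2 * pi * norm (deriv g 0) = perimeter f"
  obtains c c1 \<nu> where "admissible \<nu>" "\<And>w. w \<in> unit_disk \<Longrightarrow> f w = c * extremal_map \<nu> w + c1"
proof (cases "deriv g 0 = 0")
  case True
  have "admissible (\<lambda>w. 0 / (1 - w\<^sup>2 * 0))" by (rule admissibleI) auto
  moreover have "f w = 0 * extremal_map (\<lambda>w. 0 / (1 - w\<^sup>2 * 0)) w + f 0" if "w \<in> unit_disk" for w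
    using constant_if_perimeter_0[OF _ that] eq True by simp
  ultimately show ?thesis by (rule that)
next
  case False
  define \<alpha> where "\<alpha> = deriv g 0"
  have \<alpha>: "\<alpha> \<noteq> 0" using False by (simp add: \<alpha>_def)
  define k where "k = (\<lambda>w. deriv h w / cnj \<alpha>)"
  define \<nu> where "\<nu> = (\<lambda>w. k w / (1 - w\<^sup>2 * k w))"
  have extremal: "deriv g w / \<alpha> + w\<^sup>2 * k w = 1" "Re (w\<^sup>2 * k w) < 1 / 2" if "w \<in> unit_disk" for w
    using deriv_0_eq_iff_normalized[of \<alpha>] eq \<alpha> that by (auto simp: \<alpha>_def k_def)
  have "k holomorphic_on unit_disk"
    unfolding k_def using \<alpha> by (intro holomorphic_intros derivs_holomorphic) auto
  from admissibleI[OF this extremal(2)] have \<nu>: "admissible \<nu>" by (simp add: \<nu>_def)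
  note parts = extremal_map_parts[OF \<nu>]
  define G where "G = disk_primitive (\<lambda>z. 1 / (1 + z ^ 2 * \<nu> z))"
  define K where "K = disk_primitive (\<lambda>z. \<nu> z / (1 + z ^ 2 * \<nu> z))"
  have const: "g w - \<alpha> * G w = g 0 - \<alpha> * G 0 \<and> h w - cnj \<alpha> * K w = h 0 - cnj \<alpha> * K 0"
    if w: "w \<in> unit_disk" for w
  proof -
    have nz: "1 - w\<^sup>2 * k w \<noteq> 0" if "w \<in> unit_disk" for w
      by (rule one_minus_nonzero_if_Re_less_half[OF extremal(2)[OF that]])
    have "1 + w\<^sup>2 * \<nu> w = 1 / (1 - w\<^sup>2 * k w)" if "w \<in> unit_disk" for w
      using nz[OF that] by (simp add: \<nu>_def field_simps)
    hence quot: "\<alpha> * (1 / (1 + w\<^sup>2 * \<nu> w)) = deriv g w" "cnj \<alpha> * (\<nu> w / (1 + w\<^sup>2 * \<nu> w)) = deriv h w"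
      if "w \<in> unit_disk" for w
      using extremal(1)[OF that] nz[OF that] \<alpha> that by (auto simp: \<nu>_def k_def field_simps)
    have "((\<lambda>w. g w - \<alpha> * G w) has_field_derivative 0) (at w within unit_disk)"
      "((\<lambda>w. h w - cnj \<alpha> * K w) has_field_derivative 0) (at w within unit_disk)"
      if w: "w \<in> unit_disk" for w
      using DERIV_diff[OF holomorphic_derivI[OF g_hol _ w] DERIV_cmult[OF parts(3)[OF w], of \<alpha>]]
        DERIV_diff[OF holomorphic_derivI[OF h_hol _ w] DERIV_cmult[OF parts(4)[OF w], of "cnj \<alpha>"]]
      unfolding quot[OF w] G_def K_def by (auto intro: has_field_derivative_at_within)
    from has_field_derivative_zero_constant[OF convex_ball this(1)]
      has_field_derivative_zero_constant[OF convex_ball this(2)]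
    show ?thesis using w by (metis centre_in_ball zero_less_one)
  qed
  show ?thesis
  proof (rule that[of \<nu> \<alpha> "g 0 - \<alpha> * G 0 + cnj (h 0 - cnj \<alpha> * K 0)", OF \<nu>])
    fix w assume w: "w \<in> unit_disk"
    have gh: "g w = \<alpha> * G w + (g 0 - \<alpha> * G 0)" "h w = cnj \<alpha> * K w + (h 0 - cnj \<alpha> * K 0)"
      using const[OF w] by (simp_all add: algebra_simps)
    show "f w = \<alpha> * extremal_map \<nu> w + (g 0 - \<alpha> * G 0 + cnj (h 0 - cnj \<alpha> * K 0))"
      unfolding f_eq[OF w] gh parts(5)[of w, folded G_def K_def] by (simp add: algebra_simps)
  qed
qed

lemma deriv_0_eq_if_extremal_map:
  assumes \<nu>: "admissible \<nu>" and f: "\<And>w. w \<in> unit_disk \<Longrightarrow> f w = c * extremal_map \<nu> w + c1"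
  shows "2 * pi * norm (deriv g 0) = perimeter f"
proof -
  note parts = extremal_map_parts[OF \<nu>]
  define G where "G = disk_primitive (\<lambda>z. 1 / (1 + z ^ 2 * \<nu> z))"
  define K where "K = disk_primitive (\<lambda>z. \<nu> z / (1 + z ^ 2 * \<nu> z))"
  note parts' = parts[folded G_def K_def]
  have derivs: "deriv g w = c * (1 / (1 + w\<^sup>2 * \<nu> w))" "deriv h w = cnj c * (\<nu> w / (1 + w\<^sup>2 * \<nu> w))"
    if w: "w \<in> unit_disk" for w
  proof -
    have hol: "(\<lambda>w. c * G w + c1) holomorphic_on unit_disk" "(\<lambda>w. cnj c * K w) holomorphic_on unit_disk"
      by (intro holomorphic_intros parts')+
    have "g v + cnj (h v) = c * G v + c1 + cnj (cnj c * K v)" if "v \<in> unit_disk" for v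
      using f[OF that] f_eq[OF that] parts'(5)[of v] by (simp add: algebra_simps)
    note eq = harmonic_parts_unique[OF g_hol h_hol hol this w]
    have "((\<lambda>w. c * G w + c1) has_field_derivative c * (1 / (1 + w\<^sup>2 * \<nu> w)) + 0) (at w)"
      by (intro DERIV_add DERIV_cmult parts' w DERIV_const)
    thus "deriv g w = c * (1 / (1 + w\<^sup>2 * \<nu> w))" using eq(1) DERIV_imp_deriv by fastforce
    have "((\<lambda>w. cnj c * K w) has_field_derivative cnj c * (\<nu> w / (1 + w\<^sup>2 * \<nu> w))) (at w)"
      by (intro DERIV_cmult parts' w)
    thus "deriv h w = cnj c * (\<nu> w / (1 + w\<^sup>2 * \<nu> w))" using eq(2) DERIV_imp_deriv by fastforce
  qed
  have g0: "deriv g 0 = c" using derivs(1)[of 0] by simp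
  show ?thesis
  proof (cases "c = 0")
    case True
    have "x \<le> 2 * pi * 0" if "x \<in> polygonal_sums (\<lambda>t. f (cis t)) 0 (2 * pi)" for x
      by (rule perimeter_le_if_extremal_derivs[OF _ _ that]) (simp_all add: derivs True)
    hence "perimeter f \<le> 2 * pi * 0" by (intro curve_length_le) auto
    thus ?thesis using perimeter_nonneg g0 True by simp
  next
    case False
    have "deriv g w / c + w\<^sup>2 * (deriv h w / cnj c) = 1 \<and> Re (w\<^sup>2 * (deriv h w / cnj c)) < 1 / 2"
      if w: "w \<in> unit_disk" for w
    proof
      define \<omega> where "\<omega> = w\<^sup>2 * \<nu> w"
      have \<omega>: "norm \<omega> < 1" "1 + \<omega> \<noteq> 0" using admissible_denominator[OF \<nu> w] by (auto simp: \<omega>_def)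
      have "w\<^sup>2 * (deriv h w / cnj c) = \<omega> / (1 + \<omega>)" "deriv g w / c = 1 / (1 + \<omega>)"
        using False unfolding derivs[OF w] \<omega>_def by simp_all
      note eq = this
      show "deriv g w / c + w\<^sup>2 * (deriv h w / cnj c) = 1"
        unfolding eq using \<omega>(2) by (simp add: add_divide_distrib[symmetric])
      have "1 - \<omega> / (1 + \<omega>) = 1 / (1 + \<omega>)" using \<omega>(2) by (simp add: field_simps)
      hence "norm (\<omega> / (1 + \<omega>)) < norm (1 - \<omega> / (1 + \<omega>))"
        using \<omega> by (simp add: norm_divide divide_strict_right_mono)
      thus "Re (w\<^sup>2 * (deriv h w / cnj c)) < 1 / 2" unfolding eq by (simp only: Re_less_half_iff)
    qed
    thus ?thesis using deriv_0_eq_iff_normalized[OF g0 False] by blast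
  qed
qed

lemma deriv_0_eq_iff_extremal_map:
  "2 * pi * norm (deriv g 0) = perimeter f \<longleftrightarrow>
    (\<exists>c c1 \<nu>. admissible \<nu> \<and> (\<forall>w\<in>unit_disk. f w = c * extremal_map \<nu> w + c1))"
proof
  assume "2 * pi * norm (deriv g 0) = perimeter f"
  then obtain c c1 \<nu> where "admissible \<nu>" "\<And>w. w \<in> unit_disk \<Longrightarrow> f w = c * extremal_map \<nu> w + c1"
    by (rule extremal_map_if_deriv_0_eq) blast
  thus "\<exists>c c1 \<nu>. admissible \<nu> \<and> (\<forall>w\<in>unit_disk. f w = c * extremal_map \<nu> w + c1)" by blast
qed (use deriv_0_eq_if_extremal_map in blast)

end

section \<open>Estimates at arbitrary points\<close>

context rectifiable_disk_map
begin

lemma deriv_le: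
  assumes z: "z \<in> unit_disk"
  shows "2 * pi * (1 - (norm z)\<^sup>2) * norm (deriv g z) \<le> perimeter f"
    and "2 * pi * (1 - (norm z)\<^sup>2) * norm (deriv g z) = perimeter f \<longleftrightarrow>
      (\<exists>c c1 \<nu>. admissible \<nu> \<and> (\<forall>w\<in>unit_disk. f w = c * extremal_map \<nu> (disk_aut z w) + c1))"
proof -
  have z': "norm z < 1" using z by simp
  interpret z: rectifiable_disk_map "\<lambda>w. f (disk_aut z w)" "\<lambda>w. g (disk_aut z w)" "\<lambda>w. h (disk_aut z w)"
    by (rule precompose_disk_aut[OF z'])
  note transfer = precompose_disk_aut(2)[OF z'] norm_deriv_precompose_disk_aut[OF z']
  show "2 * pi * (1 - (norm z)\<^sup>2) * norm (deriv g z) \<le> perimeter f"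
    using z.deriv_0_le unfolding transfer by (simp add: mult.assoc)
  have swap: "(\<forall>w\<in>unit_disk. f (disk_aut z w) = E w) \<longleftrightarrow> (\<forall>w\<in>unit_disk. f w = E (disk_aut z w))" for E
  proof (intro iffI ballI)
    fix w assume "\<forall>w\<in>unit_disk. f (disk_aut z w) = E w" and w: "w \<in> unit_disk"
    from bspec[OF this(1), of "disk_aut z w"] w show "f w = E (disk_aut z w)"
      using disk_aut_in_disk[OF z'] disk_aut_involution[OF z', of w] by simp
  next
    fix w assume "\<forall>w\<in>unit_disk. f w = E (disk_aut z w)" and w: "w \<in> unit_disk"
    from bspec[OF this(1), of "disk_aut z w"] w show "f (disk_aut z w) = E w"
      using disk_aut_in_disk[OF z'] disk_aut_involution[OF z', of w] by simp
  qed
  show "2 * pi * (1 - (norm z)\<^sup>2) * norm (deriv g z) = perimeter f \<longleftrightarrow>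
      (\<exists>c c1 \<nu>. admissible \<nu> \<and> (\<forall>w\<in>unit_disk. f w = c * extremal_map \<nu> (disk_aut z w) + c1))"
    using z.deriv_0_eq_iff_extremal_map unfolding transfer swap by (simp only: mult.assoc)
qed

lemma deriv_antiholomorphic_le:
  assumes z: "z \<in> unit_disk"
  shows "2 * pi * (1 - (norm z)\<^sup>2) * norm (deriv h z) \<le> perimeter f"
proof -
  interpret c: rectifiable_disk_map "\<lambda>z. cnj (f z)" h g by (rule conjugate)
  show ?thesis by (rule order_trans[OF c.deriv_le(1)[OF z] conjugate(2)])
qed

lemma wirtinger_derivatives:
  assumes z: "z \<in> unit_disk"
  shows "wirtinger_d f z = deriv g z" "wirtinger_dbar f z = cnj (deriv h z)"
proof -
  have "(g has_derivative (\<lambda>v. deriv g z * v)) (at z)" "(h has_derivative (\<lambda>v. deriv h z * v)) (at z)"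
    using holomorphic_derivI[OF g_hol _ z] holomorphic_derivI[OF h_hol _ z]
    by (auto simp: has_field_derivative_def)
  hence "((\<lambda>w. g w + cnj (h w)) has_derivative (\<lambda>v. deriv g z * v + cnj (deriv h z * v))) (at z)"
    by (intro derivative_intros)
  hence "(f has_derivative (\<lambda>v. deriv g z * v + cnj (deriv h z * v))) (at z)"
    by (rule has_derivative_transform_within_open[OF _ open_ball z]) (simp add: f_eq)
  hence "frechet_derivative f (at z) = (\<lambda>v. deriv g z * v + cnj (deriv h z * v))"
    by (rule frechet_derivative_at[symmetric])
  thus "wirtinger_d f z = deriv g z" "wirtinger_dbar f z = cnj (deriv h z)"
    by (simp_all add: wirtinger_d_def wirtinger_dbar_def algebra_simps)
qed

lemma lambda_min_le:
  assumes z: "z \<in> unit_disk"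
  shows "2 * pi * (1 - (norm z)\<^sup>2) * lambda_min f z \<le> perimeter f"
proof -
  have "0 \<le> 2 * pi * (1 - (norm z)\<^sup>2)" using z by (simp add: power_le_one)
  moreover have "lambda_min f z \<le> max (norm (deriv g z)) (norm (deriv h z))"
    unfolding lambda_min_def wirtinger_derivatives[OF z] complex_mod_cnj max_def
    using norm_ge_zero[of "deriv g z"] norm_ge_zero[of "deriv h z"] by (auto simp: abs_if)
  ultimately have "2 * pi * (1 - (norm z)\<^sup>2) * lambda_min f z \<le>
      2 * pi * (1 - (norm z)\<^sup>2) * max (norm (deriv g z)) (norm (deriv h z))"
    by (intro mult_left_mono)
  also have "\<dots> \<le> perimeter f"
    using deriv_le(1)[OF z] deriv_antiholomorphic_le[OF z] by (simp add: max_def)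
  finally show ?thesis .
qed

lemma power_series_coefficient_le:
  assumes "\<And>z. z \<in> unit_disk \<Longrightarrow> (\<lambda>k. g_coeff k * z ^ k) sums g z"
  shows "2 * pi * real k * norm (g_coeff k) \<le> perimeter f"
proof (cases k)
  case 0
  thus ?thesis using perimeter_nonneg by simp
next
  case (Suc m)
  have "\<forall>\<^sub>F u in nhds 0. u \<in> unit_disk" by (rule eventually_nhds_in_open) auto
  hence "\<forall>\<^sub>F u in nhds 0. (\<lambda>n. fps_nth (Abs_fps g_coeff) n * u ^ n) sums g u"
    by eventually_elim (use assms in simp)
  hence "g has_fps_expansion Abs_fps g_coeff" by (rule has_fps_expansionI)
  from fps_nth_fps_expansion[OF this, of k]
  have "g_coeff k = (deriv ^^ Suc m) g 0 / fact (Suc m)" by (simp only: Suc fps_nth_Abs_fps)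
  hence "real k * norm (g_coeff k) = norm ((deriv ^^ Suc m) g 0 / fact m)"
    by (simp add: Suc norm_divide norm_mult del: funpow.simps of_nat_Suc)
  thus ?thesis using coefficient_le[of m] by (simp add: mult.assoc)
qed

end

theorem theorem10:
  fixes f g h :: "complex \<Rightarrow> complex" and g_coeff :: "nat \<Rightarrow> complex" and L :: real
  assumes f_cont: "continuous_on (cball 0 1) f"
    and f_harm: "harmonic_on f unit_disk"
    and g_hol: "g holomorphic_on unit_disk"
    and h_hol: "h holomorphic_on unit_disk"
    and f_eq: "\<And>z. z \<in> unit_disk \<Longrightarrow> f z = g z + cnj (h z)"
    and rect: "rectifiable_curve (\<lambda>t. f (cis t)) 0 (2 * pi)"
    and L_eq: "L = curve_length (\<lambda>t. f (cis t)) 0 (2 * pi)"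
    and g_coeff: "\<And>z. z \<in> unit_disk \<Longrightarrow> (\<lambda>k. g_coeff k * z ^ k) sums g z"
  shows
    \<comment> \<open>a)\<close>
    "(\<forall>k. 2 * pi * real k * norm (g_coeff k) \<le> L) \<and>
    \<comment> \<open>a1)\<close>
     2 * pi * norm (deriv g 0) \<le> L \<and>
     (\<forall>a::real. a > 0 \<and> deriv g 0 = of_real a \<longrightarrow>
        (2 * pi * norm (deriv g 0) = L \<longleftrightarrow>
          (\<exists>H. H holomorphic_on unit_disk \<and> zero_of_order_ge 2 H \<and>
               (\<forall>z\<in>unit_disk. deriv g z = - H z + of_real a) \<and>
               (\<forall>z\<in>unit_disk - {0}. deriv h z = H z / z ^ 2) \<and>
               (\<lambda>z. 2 * H z) \<in> halfplane_family a))) \<and>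
    \<comment> \<open>a2)\<close>
     2 * pi * max (norm (deriv g 0)) (norm (deriv h 0)) \<le> L \<and>
    \<comment> \<open>a3)\<close>
     2 * pi * norm (deriv g 0) \<le> L \<and>
     (2 * pi * norm (deriv g 0) = L \<longleftrightarrow>
        (\<exists>c c1 \<nu>. admissible \<nu> \<and> (\<forall>w\<in>unit_disk. f w = c * extremal_map \<nu> w + c1))) \<and>
    \<comment> \<open>b)\<close>
     (\<forall>z\<in>unit_disk.
        2 * pi * (1 - (norm z)\<^sup>2) * norm (deriv g z) \<le> L \<and>
        (2 * pi * (1 - (norm z)\<^sup>2) * norm (deriv g z) = L \<longleftrightarrow>
          (\<exists>c c1 \<nu>. admissible \<nu> \<and>
             (\<forall>w\<in>unit_disk. f w = c * extremal_map \<nu> (disk_aut z w) + c1)))) \<and>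
    \<comment> \<open>b1)\<close>
     (\<forall>z\<in>unit_disk. 2 * pi * (1 - (norm z)\<^sup>2) * lambda_min f z \<le> L)"
proof -
  interpret rectifiable_disk_map f g h
    using f_cont g_hol h_hol f_eq rect by unfold_locales
  have "2 * pi * norm (deriv h 0) \<le> L" using deriv_antiholomorphic_le[of 0] by (simp add: L_eq)
  hence max: "2 * pi * max (norm (deriv g 0)) (norm (deriv h 0)) \<le> perimeter f"
    using deriv_0_le by (simp add: L_eq max_def)
  show ?thesis
    unfolding L_eq
    by (intro conjI allI ballI impI; (elim conjE)?;
        rule power_series_coefficient_le[OF g_coeff] deriv_0_le deriv_0_eq_iff_halfplane max
          deriv_0_eq_iff_extremal_map deriv_le lambda_min_le; assumption)
qed

end
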